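(* Let $(F^4,g)$ be the Riemannian manifold described in the context. Any harmonic map from a compact orientable Riemannian manifold with no boundary to $(F^4,g)$ must be constant.
   Context: $F^4=\mathbb{R}^2\times\mathbb{H}^2$ with global coordinates $(x,y,s,t)$, where $(x,y)\in\mathbb{R}^2$ and $(s,t)$, $t>0$, are upper half-plane coordinates on $\mathbb{H}^2$. The Riemannian metric is $g=\theta_1^2+\theta_2^2+\theta_3^2+\theta_4^2$ with $$\theta_1=\tfrac{1}{\sqrt t}dx-\tfrac{s}{\sqrt t}dy,\quad \theta_2=\sqrt t\,dy,\quad \theta_3=\tfrac{1}{2t}ds,\quad \theta_4=\tfrac{1}{2t}dt.$$ A smooth map $\varphi\colon(M,h)\to(N,k)$ between Riemannian manifolds is harmonic if it is a critical point of the energy functional $E(\varphi;D)=\frac12\int_D|d\varphi|^2\,v^h$ (for compact domains $D\subset M$, with $v^h$ the Riemannian volume element of $(M,h)$ and $|d\varphi|$ the Hilbert--Schmidt norm of $d\varphi$); the associated Euler--Lagrange equation is $\tau(\varphi)=\mathrm{Tr}_h\nabla d\varphi=\sum_{i}\big(\nabla^{\varphi}_{E_i}d\varphi(E_i)-d\varphi(\nabla^M_{E_i}E_i)\big)=0$, where $\{E_i\}$ is a local orthonormal frame on $(M,h)$, $\nabla^M$ is the Levi-Civita connection of $(M,h)$ and $\nabla^\varphi$ is the pull-back connection on $\varphi^{-1}TN$.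
   Formalization: The compact source manifold is additionally assumed connected (a common convention); on a disconnected manifold, a map taking different constant values on different components is harmonic but not constant. *)

theory Defs
  imports "HOL-Analysis.Analysis"
begin

section \<open>Smooth functions on open subsets of normed spaces\<close>

primrec Ck_on :: "nat \<Rightarrow> ('a::real_normed_vector \<Rightarrow> 'b::real_normed_vector) \<Rightarrow> 'a set \<Rightarrow> bool" where
  "Ck_on 0 f S \<longleftrightarrow> continuous_on S f"
| "Ck_on (Suc k) f S \<longleftrightarrow>
     (\<forall>x\<in>S. f differentiable (at x)) \<and>
     (\<forall>v. Ck_on k (\<lambda>x. frechet_derivative f (at x) v) S)"

text \<open>Only used for \<open>S\<close> open in a finite-dimensional space.\<close>

definition smooth_on :: "('a::real_normed_vector \<Rightarrow> 'b::real_normed_vector) \<Rightarrow> 'a set \<Rightarrow> bool" where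
  "smooth_on f S \<longleftrightarrow> (\<forall>k. Ck_on k f S)"

section \<open>Smooth manifolds without boundary\<close>

text \<open>The manifold is the whole type \<open>'m\<close> (Hausdorff and second countable by its sort); charts
  are pairs of an open domain and a coordinate map, meaningful on that domain only. All charts map
  onto open subsets of \<open>real^'n\<close>, so there is no boundary. The order on the index type \<open>'n\<close>
  plays no role; its sort is that of the change of variables theorems in
  \<^theory>\<open>HOL-Analysis.Change_Of_Vars\<close>, and every dimension at least 1 has such an
  index type.\<close>

type_synonym ('m, 'n) chart = "'m set \<times> ('m \<Rightarrow> real^'n)"

definition chart_inv :: "('m, 'n) chart \<Rightarrow> real^'n \<Rightarrow> 'm" where
  "chart_inv C = inv_into (fst C) (snd C)"

definition transition :: "('m, 'n) chart \<Rightarrow> ('m, 'n) chart \<Rightarrow> real^'n \<Rightarrow> real^'n" where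
  "transition C D = snd D \<circ> chart_inv C"

definition smooth_atlas ::
  "('m::{t2_space,second_countable_topology}, 'n::{finite,wellorder}) chart set \<Rightarrow> bool" where
  "smooth_atlas A \<longleftrightarrow>
     (\<Union>C\<in>A. fst C) = UNIV \<and>
     (\<forall>C\<in>A. open (fst C) \<and> open (snd C ` fst C) \<and>
        homeomorphism (fst C) (snd C ` fst C) (snd C) (chart_inv C)) \<and>
     (\<forall>C\<in>A. \<forall>D\<in>A. smooth_on (transition C D) (snd C ` (fst C \<inter> fst D)))"

definition orientable ::
  "('m::{t2_space,second_countable_topology}, 'n::{finite,wellorder}) chart set \<Rightarrow> bool" where
  "orientable A \<longleftrightarrow>
     (\<exists>B. smooth_atlas B \<and> smooth_atlas (A \<union> B) \<and>
        (\<forall>C\<in>B. \<forall>D\<in>B. \<forall>p\<in>fst C \<inter> fst D.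
           det (matrix (frechet_derivative (transition C D) (at (snd C p)))) > 0))"

section \<open>Riemannian metrics and the volume measure\<close>

text \<open>A metric is given in coordinates: \<open>h C p\<close> is the inner product on the tangent space at
  \<open>p\<close>, transported to \<open>real^'n\<close> by the chart \<open>C\<close>.\<close>

type_synonym ('m, 'n) metric = "('m, 'n) chart \<Rightarrow> 'm \<Rightarrow> real^'n \<Rightarrow> real^'n \<Rightarrow> real"

definition riemannian_metric ::
  "('m::{t2_space,second_countable_topology}, 'n::{finite,wellorder}) chart set
     \<Rightarrow> ('m, 'n) metric \<Rightarrow> bool" where
  "riemannian_metric A h \<longleftrightarrow>
     (\<forall>C\<in>A. \<forall>p\<in>fst C. bilinear (h C p) \<and>
        (\<forall>v w. h C p v w = h C p w v) \<and> (\<forall>v. v \<noteq> 0 \<longrightarrow> h C p v v > 0)) \<and>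
     (\<forall>C\<in>A. \<forall>v w. smooth_on (\<lambda>x. h C (chart_inv C x) v w) (snd C ` fst C)) \<and>
     (\<forall>C\<in>A. \<forall>D\<in>A. \<forall>p\<in>fst C \<inter> fst D. \<forall>v w.
        h C p v w =
        h D p (frechet_derivative (transition C D) (at (snd C p)) v)
              (frechet_derivative (transition C D) (at (snd C p)) w))"

definition volume_density ::
  "('m, 'n::{finite,wellorder}) metric \<Rightarrow> ('m, 'n) chart \<Rightarrow> 'm \<Rightarrow> real" where
  "volume_density h C p = sqrt (det (\<chi> i j. h C p (axis i 1) (axis j 1)))"

text \<open>The unique Borel measure given by \<open>sqrt (det h) dx\<close> in every chart.\<close>

definition riemannian_volume ::
  "('m::{t2_space,second_countable_topology}, 'n::{finite,wellorder}) chart set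
     \<Rightarrow> ('m, 'n) metric \<Rightarrow> 'm measure" where
  "riemannian_volume A h =
     (THE \<mu>. sets \<mu> = sets borel \<and>
        (\<forall>C\<in>A. \<forall>B\<in>sets borel. B \<subseteq> fst C \<longrightarrow>
           emeasure \<mu> B =
             (\<integral>\<^sup>+x\<in>snd C ` B. ennreal (volume_density h C (chart_inv C x)) \<partial>lborel)))"

section \<open>Energy and harmonic maps\<close>

text \<open>The target is an open subset \<open>N\<close> of a normed space (a manifold with global coordinates)
  with metric \<open>k\<close>, where \<open>k q\<close> is the inner product on the tangent space at \<open>q\<close>.\<close>

definition smooth_map_into ::
  "('m::{t2_space,second_countable_topology}, 'n::{finite,wellorder}) chart set
     \<Rightarrow> 'e::real_normed_vector set \<Rightarrow> ('m \<Rightarrow> 'e) \<Rightarrow> bool" where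
  "smooth_map_into A N \<phi> \<longleftrightarrow>
     range \<phi> \<subseteq> N \<and> (\<forall>C\<in>A. smooth_on (\<phi> \<circ> chart_inv C) (snd C ` fst C))"

definition orthonormal_frame ::
  "(real^'n \<Rightarrow> real^'n \<Rightarrow> real) \<Rightarrow> ('n::finite \<Rightarrow> real^'n) \<Rightarrow> bool" where
  "orthonormal_frame a e \<longleftrightarrow> (\<forall>i j. a (e i) (e j) = (if i = j then 1 else 0))"

text \<open>Squared Hilbert--Schmidt norm of a linear map \<open>L\<close> between spaces with inner products
  \<open>a\<close> and \<open>b\<close>; it does not depend on the chosen frame.\<close>

definition hs_norm_sq ::
  "(real^'n \<Rightarrow> real^'n \<Rightarrow> real) \<Rightarrow> ('e \<Rightarrow> 'e \<Rightarrow> real) \<Rightarrow> (real^'n::finite \<Rightarrow> 'e) \<Rightarrow> real" where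
  "hs_norm_sq a b L = (let e = (SOME e. orthonormal_frame a e) in \<Sum>i\<in>UNIV. b (L (e i)) (L (e i)))"

text \<open>\<open>|d\<phi>|\<^sup>2\<close> at \<open>p\<close>, computed in some chart around \<open>p\<close>; it does not depend on the chart.\<close>

definition norm_sq_differential ::
  "('m::{t2_space,second_countable_topology}, 'n::{finite,wellorder}) chart set
     \<Rightarrow> ('m, 'n) metric \<Rightarrow> ('e \<Rightarrow> 'e \<Rightarrow> 'e \<Rightarrow> real) \<Rightarrow> ('m \<Rightarrow> 'e::real_normed_vector)
     \<Rightarrow> 'm \<Rightarrow> real" where
  "norm_sq_differential A h k \<phi> p =
     (let C = (SOME C. C \<in> A \<and> p \<in> fst C) in
      hs_norm_sq (h C p) (k (\<phi> p)) (frechet_derivative (\<phi> \<circ> chart_inv C) (at (snd C p))))"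

definition energy ::
  "('m::{t2_space,second_countable_topology}, 'n::{finite,wellorder}) chart set
     \<Rightarrow> ('m, 'n) metric \<Rightarrow> ('e \<Rightarrow> 'e \<Rightarrow> 'e \<Rightarrow> real) \<Rightarrow> ('m \<Rightarrow> 'e::real_normed_vector)
     \<Rightarrow> 'm set \<Rightarrow> real" where
  "energy A h k \<phi> D = 1/2 * (LINT p:D|riemannian_volume A h. norm_sq_differential A h k \<phi> p)"

definition compact_domain :: "'m::topological_space set \<Rightarrow> bool" where
  "compact_domain D \<longleftrightarrow> compact D \<and> connected (interior D) \<and> D = closure (interior D)"

text \<open>A smooth variation \<open>\<Phi> u\<close>, \<open>|u| < \<delta>\<close>, of \<open>\<phi>\<close> that is supported in the interior of \<open>D\<close>
  (the interior is all of \<open>D\<close> if \<open>D\<close> is the whole manifold).\<close>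

definition smooth_variation ::
  "('m::{t2_space,second_countable_topology}, 'n::{finite,wellorder}) chart set
     \<Rightarrow> 'e::real_normed_vector set \<Rightarrow> ('m \<Rightarrow> 'e) \<Rightarrow> 'm set \<Rightarrow> real \<Rightarrow> (real \<Rightarrow> 'm \<Rightarrow> 'e)
     \<Rightarrow> bool" where
  "smooth_variation A N \<phi> D \<delta> \<Phi> \<longleftrightarrow>
     (\<forall>p. \<Phi> 0 p = \<phi> p) \<and>
     (\<forall>u\<in>{-\<delta><..<\<delta>}. range (\<Phi> u) \<subseteq> N) \<and>
     (\<forall>C\<in>A. smooth_on (\<lambda>(u, x). \<Phi> u (chart_inv C x)) ({-\<delta><..<\<delta>} \<times> snd C ` fst C)) \<and>
     closure {p. \<exists>u\<in>{-\<delta><..<\<delta>}. \<Phi> u p \<noteq> \<phi> p} \<subseteq> interior D"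

definition harmonic_map ::
  "('m::{t2_space,second_countable_topology}, 'n::{finite,wellorder}) chart set
     \<Rightarrow> ('m, 'n) metric \<Rightarrow> 'e::real_normed_vector set \<Rightarrow> ('e \<Rightarrow> 'e \<Rightarrow> 'e \<Rightarrow> real)
     \<Rightarrow> ('m \<Rightarrow> 'e) \<Rightarrow> bool" where
  "harmonic_map A h N k \<phi> \<longleftrightarrow>
     smooth_map_into A N \<phi> \<and>
     (\<forall>D \<delta> \<Phi>. compact_domain D \<and> \<delta> > 0 \<and> smooth_variation A N \<phi> D \<delta> \<Phi> \<longrightarrow>
        ((\<lambda>u. energy A h k (\<Phi> u) D) has_real_derivative 0) (at 0))"

section \<open>The space \<open>F\<^sup>4\<close>\<close>

text \<open>Points are \<open>(x, y, s, t)\<close> with \<open>t > 0\<close>; a tangent vector is its list of coordinates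
  \<open>(dx, dy, ds, dt)\<close>.\<close>

type_synonym real4 = "real \<times> real \<times> real \<times> real"

definition F4 :: "real4 set" where
  "F4 = {(x, y, s, t). t > 0}"

fun theta1 :: "real4 \<Rightarrow> real4 \<Rightarrow> real" where
  "theta1 (x, y, s, t) (dx, dy, ds, dt) = 1 / sqrt t * dx - s / sqrt t * dy"

fun theta2 :: "real4 \<Rightarrow> real4 \<Rightarrow> real" where
  "theta2 (x, y, s, t) (dx, dy, ds, dt) = sqrt t * dy"

fun theta3 :: "real4 \<Rightarrow> real4 \<Rightarrow> real" where
  "theta3 (x, y, s, t) (dx, dy, ds, dt) = 1 / (2 * t) * ds"

fun theta4 :: "real4 \<Rightarrow> real4 \<Rightarrow> real" where
  "theta4 (x, y, s, t) (dx, dy, ds, dt) = 1 / (2 * t) * dt"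

definition F4_metric :: "real4 \<Rightarrow> real4 \<Rightarrow> real4 \<Rightarrow> real" where
  "F4_metric q v w =
     theta1 q v * theta1 q w + theta2 q v * theta2 q w +
     theta3 q v * theta3 q w + theta4 q v * theta4 q w"

end

theory Submission
  imports Defs
begin

text \<open>Since the source is compact, it is a compact domain itself and every smooth variation of the
  map is admissible. Scaling \<open>(x, y)\<close> by \<open>1 + u\<close> multiplies \<open>\<theta>\<^sub>1\<close> and \<open>\<theta>\<^sub>2\<close> by
  \<open>1 + u\<close> and fixes \<open>\<theta>\<^sub>3\<close> and \<open>\<theta>\<^sub>4\<close>, so the energy becomes \<open>a + (1 + u)\<^sup>2 b\<close>, where
  \<open>b\<close> is the energy in the directions \<open>\<theta>\<^sub>1, \<theta>\<^sub>2\<close>. Criticality forces \<open>b = 0\<close>, hence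
  \<open>dx = dy = 0\<close> along the map. Now the same argument applies to \<open>s \<mapsto> (1 + u) s\<close>, and then to
  \<open>t \<mapsto> t powr (1 + u)\<close>, which scales \<open>dt / t\<close>. About the source one only
  needs that its Riemannian volume is finite and positive on open sets and that energy densities are
  continuous.\<close>

text \<open>Neither the tension field nor the Levi-Civita connection appears: along each variation
  the energy is exactly a quadratic polynomial in \<open>u\<close>, so nothing is differentiated
  under the integral. The order of the variations is forced. No coefficient of the four forms
  involves \<open>x\<close> or \<open>y\<close>, so the first scaling law holds on all vectors. But
  \<open>s\<close> enters \<open>theta1\<close> through its \<open>dy\<close> term, so scaling
  \<open>s\<close> is harmless only once \<open>dy = 0\<close>, and \<open>t\<close> enters every
  form, so its power acts on \<open>theta4\<close> alone only once the other three vanish along the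
  map. Scaling laws are therefore demanded only on the range of the differential. Most of the length
  comes from the definitions. The volume is a definite description, so the measure must be shown to
  exist uniquely before anything is known about it. The energy density uses an arbitrarily chosen
  chart and frame, which may jump from point to point; its continuity only shows after the frame has
  been replaced by the inverse Gram matrix.\<close>

section \<open>Calculus of functions of class \<open>C\<^sup>k\<close>\<close>

lemma Ck_on_cong:
  assumes "open S" "\<And>x. x \<in> S \<Longrightarrow> f x = g x" "Ck_on k f S"
  shows "Ck_on k g S"
  using assms(2,3)
proof (induction k arbitrary: f g)
  case 0
  then show ?case by (simp cong: continuous_on_cong)
next
  case (Suc k)
  have der: "(g has_derivative frechet_derivative f (at x)) (at x)" if "x \<in> S" for x
    using Suc.prems that assms(1) frechet_derivative_works
    by (intro has_derivative_transform_within_open[of f _ x UNIV S g]) auto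
  have eq: "frechet_derivative f (at x) v = frechet_derivative g (at x) v" if "x \<in> S" for x v
    using frechet_derivative_at[OF der[OF that]] by simp
  have "Ck_on k (\<lambda>x. frechet_derivative g (at x) v) S" for v
    using Suc.prems by (intro Suc.IH[OF eq]) auto
  then show ?case
    using der by (auto simp: differentiable_def)
qed

text \<open>On an open set a derivative is determined by the values there, so any explicit formula
  \<open>f'\<close> may stand in for the chosen \<open>frechet_derivative\<close>. The closure
  lemmas below induct through this rule.\<close>

lemma Ck_on_SucI:
  assumes "open S" "\<And>x. x \<in> S \<Longrightarrow> (f has_derivative f' x) (at x)" "\<And>v. Ck_on k (\<lambda>x. f' x v) S"
  shows "Ck_on (Suc k) f S"
proof -
  have "frechet_derivative f (at x) = f' x" if "x \<in> S" for x
    using that assms(2) frechet_derivative_at by metis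
  then show ?thesis
    using assms by (auto simp: differentiable_def intro: Ck_on_cong)
qed

lemma Ck_on_SucD:
  assumes "Ck_on (Suc k) f S"
  shows "Ck_on k f S"
  using assms
proof (induction k arbitrary: f)
  case 0
  then show ?case
    by (auto intro!: continuous_at_imp_continuous_on differentiable_imp_continuous_within)
next
  case (Suc k)
  then show ?case by (metis Ck_on.simps(2))
qed

lemma Ck_on_has_derivative:
  assumes "Ck_on (Suc k) f S" "x \<in> S"
  shows "(f has_derivative frechet_derivative f (at x)) (at x)"
  using assms by (simp add: frechet_derivative_works[THEN iffD1])

lemma Ck_on_const: "open S \<Longrightarrow> Ck_on k (\<lambda>x. c) S"
proof (induction k arbitrary: c)
  case (Suc k)
  then show ?case by (intro Ck_on_SucI[where f' = "\<lambda>x v. 0"]) auto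
qed simp

lemma Ck_on_ident: "open S \<Longrightarrow> Ck_on k (\<lambda>x. x) S"
  by (cases k) (auto intro!: Ck_on_SucI[where f' = "\<lambda>x v. v"] Ck_on_const has_derivative_ident)

lemma Ck_on_bounded_linear:
  assumes L: "bounded_linear L" and S: "open S"
  shows "Ck_on k f S \<Longrightarrow> Ck_on k (\<lambda>x. L (f x)) S"
proof (induction k arbitrary: f)
  case 0
  then show ?case using bounded_linear.continuous_on[OF L] by simp
next
  case (Suc k)
  show ?case
    using bounded_linear.has_derivative[OF L Ck_on_has_derivative[OF Suc.prems]] Suc
    by (intro Ck_on_SucI[OF S, where f' = "\<lambda>x v. L (frechet_derivative f (at x) v)"]) auto
qed

text \<open>For a linear inner map the directional derivative is again a function of
  \<open>L x\<close>, in the fixed direction \<open>L v\<close>, so the induction closes without a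
  general chain rule of order \<open>k\<close>. With \<open>L = snd\<close> it turns a map in a
  chart into a function of \<open>(u, x)\<close>.\<close>

lemma Ck_on_compose_linear:
  assumes L: "bounded_linear L" and S: "open S" and T: "open T" "L ` T \<subseteq> S"
  shows "Ck_on k f S \<Longrightarrow> Ck_on k (\<lambda>x. f (L x)) T"
proof (induction k arbitrary: f)
  case 0
  then show ?case
    using continuous_on_compose2[OF _ linear_continuous_on[OF L] T(2)] by simp
next
  case (Suc k)
  have "((\<lambda>x. f (L x)) has_derivative (\<lambda>v. frechet_derivative f (at (L x)) (L v))) (at x)"
    if "x \<in> T" for x
  proof -
    have "(f has_derivative frechet_derivative f (at (L x))) (at (L x))"
      using that T Ck_on_has_derivative[OF Suc.prems] by auto
    then show ?thesis
      using has_derivative_compose[OF bounded_linear_imp_has_derivative[OF L]] by blast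
  qed
  then show ?case
    using Suc by (intro Ck_on_SucI[OF T(1)]) auto
qed

lemma Ck_on_Pair:
  assumes S: "open S"
  shows "Ck_on k f S \<Longrightarrow> Ck_on k g S \<Longrightarrow> Ck_on k (\<lambda>x. (f x, g x)) S"
proof (induction k arbitrary: f g)
  case 0
  then show ?case by (simp add: continuous_on_Pair)
next
  case (Suc k)
  show ?case
    using Suc has_derivative_Pair[OF Ck_on_has_derivative[OF Suc.prems(1)]
        Ck_on_has_derivative[OF Suc.prems(2)]]
    by (intro Ck_on_SucI[OF S]) auto
qed

lemma Ck_on_add:
  assumes "open S" "Ck_on k f S" "Ck_on k g S"
  shows "Ck_on k (\<lambda>x. f x + g x) S"
  using Ck_on_bounded_linear[OF bounded_linear_add[OF bounded_linear_fst bounded_linear_snd]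
      assms(1) Ck_on_Pair[OF assms]] by simp

lemma Ck_on_mult:
  fixes f g :: "'a::real_normed_vector \<Rightarrow> real"
  assumes S: "open S"
  shows "Ck_on k f S \<Longrightarrow> Ck_on k g S \<Longrightarrow> Ck_on k (\<lambda>x. f x * g x) S"
proof (induction k arbitrary: f g)
  case 0
  then show ?case by (simp add: continuous_on_mult)
next
  case (Suc k)
  show ?case
    using Suc has_derivative_mult[OF Ck_on_has_derivative[OF Suc.prems(1)]
        Ck_on_has_derivative[OF Suc.prems(2)]] Ck_on_SucD[OF Suc.prems(1)] Ck_on_SucD[OF Suc.prems(2)]
    by (intro Ck_on_SucI[OF S, where f' = "\<lambda>x v. f x * frechet_derivative g (at x) v +
        frechet_derivative f (at x) v * g x"] Ck_on_add[OF S]) auto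
qed

text \<open>The derivative contains \<open>exp (f x)\<close> itself, so the induction runs over
  \<open>k\<close> with \<open>f\<close> fixed. The same device serves \<open>inverse\<close>, while
  \<open>ln\<close> reduces to \<open>inverse\<close> after one derivative.\<close>

lemma Ck_on_exp:
  fixes f :: "'a::real_normed_vector \<Rightarrow> real"
  assumes S: "open S"
  shows "Ck_on k f S \<Longrightarrow> Ck_on k (\<lambda>x. exp (f x)) S"
proof (induction k)
  case 0
  then show ?case by (simp add: continuous_on_exp)
next
  case (Suc k)
  show ?case
  proof (rule Ck_on_SucI[OF S])
    show "((\<lambda>x. exp (f x)) has_derivative (\<lambda>v. exp (f x) * frechet_derivative f (at x) v)) (at x)"
      if "x \<in> S" for x
      using Ck_on_has_derivative[OF Suc.prems that] by (auto intro!: derivative_eq_intros)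
    show "Ck_on k (\<lambda>x. exp (f x) * frechet_derivative f (at x) v) S" for v
      using Suc Ck_on_SucD[OF Suc.prems] by (auto intro!: Ck_on_mult[OF S])
  qed
qed

lemma Ck_on_inverse:
  fixes f :: "'a::real_normed_vector \<Rightarrow> real"
  assumes S: "open S" and nz: "\<And>x. x \<in> S \<Longrightarrow> f x \<noteq> 0"
  shows "Ck_on k f S \<Longrightarrow> Ck_on k (\<lambda>x. inverse (f x)) S"
proof (induction k)
  case 0
  then show ?case using nz by (simp add: continuous_on_inverse)
next
  case (Suc k)
  show ?case
  proof (rule Ck_on_SucI[OF S])
    show "((\<lambda>x. inverse (f x)) has_derivative
        (\<lambda>v. - 1 * (inverse (f x) * inverse (f x) * frechet_derivative f (at x) v))) (at x)"
      if "x \<in> S" for x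
      using Ck_on_has_derivative[OF Suc.prems that] nz[OF that] by (auto intro!: derivative_eq_intros)
    show "Ck_on k (\<lambda>x. - 1 * (inverse (f x) * inverse (f x) * frechet_derivative f (at x) v)) S" for v
      using Suc Ck_on_SucD[OF Suc.prems] by (intro Ck_on_mult[OF S] Ck_on_const[OF S]) auto
  qed
qed

lemma Ck_on_ln:
  fixes f :: "'a::real_normed_vector \<Rightarrow> real"
  assumes S: "open S" and pos: "\<And>x. x \<in> S \<Longrightarrow> f x > 0"
  shows "Ck_on k f S \<Longrightarrow> Ck_on k (\<lambda>x. ln (f x)) S"
proof (induction k)
  case 0
  then show ?case using pos by (auto intro!: continuous_intros simp: less_le)
next
  case (Suc k)
  have nz: "f x \<noteq> 0" if "x \<in> S" for x using pos[OF that] by simp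
  show ?case
  proof (rule Ck_on_SucI[OF S])
    show "((\<lambda>x. ln (f x)) has_derivative (\<lambda>v. inverse (f x) * frechet_derivative f (at x) v)) (at x)"
      if "x \<in> S" for x
      using Ck_on_has_derivative[OF Suc.prems that] pos[OF that] nz[OF that]
      by (auto intro!: derivative_eq_intros simp: field_simps)
    show "Ck_on k (\<lambda>x. inverse (f x) * frechet_derivative f (at x) v) S" for v
      using Suc Ck_on_SucD[OF Suc.prems] nz by (intro Ck_on_mult[OF S] Ck_on_inverse[OF S]) auto
  qed
qed

section \<open>Orthonormal frames and Gram matrices\<close>

definition gram :: "(real^'n \<Rightarrow> real^'n \<Rightarrow> real) \<Rightarrow> real^'n^'n" where
  "gram a = (\<chi> i j. a (axis i 1) (axis j 1))"

definition frame_matrix :: "('n \<Rightarrow> real^'n) \<Rightarrow> real^'n^'n" where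
  "frame_matrix e = (\<chi> i j. e j $ i)"

lemma linear_axis_expansion:
  fixes L :: "real^'n \<Rightarrow> 'e::real_vector"
  assumes "linear L"
  shows "L v = (\<Sum>i\<in>UNIV. v $ i *\<^sub>R L (axis i 1))"
proof -
  have "L v = L (\<Sum>i\<in>UNIV. v $ i *\<^sub>R axis i 1)"
    using basis_expansion[of v] by (simp add: scalar_mult_eq_scaleR)
  also have "\<dots> = (\<Sum>i\<in>UNIV. v $ i *\<^sub>R L (axis i 1))"
    using assms by (simp add: linear_sum linear_scale)
  finally show ?thesis .
qed

lemma bilinear_axis_expansion:
  fixes b :: "'e::real_vector \<Rightarrow> 'e \<Rightarrow> real" and L :: "real^'n \<Rightarrow> 'e"
  assumes "bilinear b" "linear L"
  shows "b (L v) (L w) =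
    (\<Sum>i\<in>UNIV. \<Sum>j\<in>UNIV. v $ i * w $ j * b (L (axis i 1)) (L (axis j 1)))"
proof -
  have "b (L v) (L w) =
      b (\<Sum>i\<in>UNIV. v $ i *\<^sub>R L (axis i 1)) (\<Sum>j\<in>UNIV. w $ j *\<^sub>R L (axis j 1))"
    using linear_axis_expansion[OF assms(2)] by metis
  also have "\<dots> = (\<Sum>i\<in>UNIV. \<Sum>j\<in>UNIV. v $ i * w $ j * b (L (axis i 1)) (L (axis j 1)))"
    by (simp add: bilinear_sum[OF assms(1)] sum.cartesian_product bilinear_lmul[OF assms(1)]
        bilinear_rmul[OF assms(1)] mult_ac)
  finally show ?thesis .
qed

lemma gram_pullback:
  fixes a :: "real^'n \<Rightarrow> real^'n \<Rightarrow> real"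
  assumes "bilinear a" "linear T"
  shows "gram (\<lambda>v w. a (T v) (T w)) = transpose (matrix T) ** gram a ** matrix T"
proof -
  have *: "a (T v) (T w) = (\<Sum>i\<in>UNIV. \<Sum>j\<in>UNIV. T v $ i * T w $ j * gram a $ i $ j)" for v w
    using bilinear_axis_expansion[OF assms(1) linear_id, of "T v" "T w"] by (simp add: gram_def)
  have "gram (\<lambda>v w. a (T v) (T w)) $ i $ j = (transpose (matrix T) ** gram a ** matrix T) $ i $ j" for i j
  proof -
    have "gram (\<lambda>v w. a (T v) (T w)) $ i $ j =
        (\<Sum>k\<in>UNIV. \<Sum>l\<in>UNIV. T (axis i 1) $ k * T (axis j 1) $ l * gram a $ k $ l)"
      using *[of "axis i 1" "axis j 1"] by (subst gram_def) simp
    also have "\<dots> = (\<Sum>l\<in>UNIV. \<Sum>k\<in>UNIV. T (axis i 1) $ k * T (axis j 1) $ l * gram a $ k $ l)"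
      by (rule sum.swap)
    finally show ?thesis
      by (simp add: matrix_matrix_mult_def transpose_def matrix_def sum_distrib_left mult_ac)
  qed
  then show ?thesis by (simp add: vec_eq_iff)
qed

text \<open>The matrix maps the standard basis to the frame, so it pulls \<open>a\<close> back to
  the standard inner product.\<close>

lemma gram_frame:
  fixes a :: "real^'n \<Rightarrow> real^'n \<Rightarrow> real"
  assumes "bilinear a" "orthonormal_frame a e"
  shows "transpose (frame_matrix e) ** gram a ** frame_matrix e = mat 1"
proof -
  define T where "T = (*v) (frame_matrix e)"
  have "linear T" by (simp add: T_def)
  have Te: "T (axis i 1) = e i" for i
    by (simp add: T_def matrix_vector_mul_component vec_eq_iff frame_matrix_def
        matrix_vector_mult_basis column_def)
  have "transpose (frame_matrix e) ** gram a ** frame_matrix e = gram (\<lambda>v w. a (T v) (T w))"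
    using gram_pullback[OF assms(1) \<open>linear T\<close>] by (simp add: T_def)
  also have "\<dots> = mat 1"
    using assms(2) by (simp add: gram_def Te orthonormal_frame_def mat_def vec_eq_iff)
  finally show ?thesis .
qed

text \<open>Writing \<open>E\<close> for the frame matrix and \<open>G\<close> for the Gram matrix,
  \<open>transpose E ** G\<close> is a left inverse of \<open>E\<close>, hence a right inverse,
  which exhibits \<open>E ** transpose E\<close> as the inverse of \<open>G\<close>. That product is
  thus the same for all orthonormal frames of \<open>a\<close>.\<close>

lemma frame_matrix_inverse_gram:
  fixes a :: "real^'n \<Rightarrow> real^'n \<Rightarrow> real"
  assumes "bilinear a" "orthonormal_frame a e"
  shows "gram a ** (frame_matrix e ** transpose (frame_matrix e)) = mat 1"
proof -
  let ?E = "frame_matrix e"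
  have "?E ** (transpose ?E ** gram a) = mat 1"
    using gram_frame[OF assms] by (simp add: matrix_left_right_inverse)
  then have "(?E ** transpose ?E) ** gram a = mat 1"
    by (simp add: matrix_mul_assoc)
  then show ?thesis by (simp add: matrix_left_right_inverse)
qed

lemma orthonormal_frame_span:
  fixes a :: "real^'n \<Rightarrow> real^'n \<Rightarrow> real"
  assumes "bilinear a" "orthonormal_frame a e" "linear L" "\<And>i. L (e i) = 0"
  shows "L v = (0 :: 'e::real_vector)"
proof -
  let ?E = "frame_matrix e"
  have "?E ** (transpose ?E ** gram a) = mat 1"
    using gram_frame[OF assms(1,2)] by (simp add: matrix_left_right_inverse)
  then have "v = ?E *v ((transpose ?E ** gram a) *v v)"
    by (simp add: matrix_vector_mul_assoc)
  also have "\<dots> = (\<Sum>i\<in>UNIV. ((transpose ?E ** gram a) *v v) $ i *\<^sub>R e i)"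
    by (simp add: matrix_mult_sum column_def frame_matrix_def scalar_mult_eq_scaleR)
  finally have "L v = L (\<Sum>i\<in>UNIV. ((transpose ?E ** gram a) *v v) $ i *\<^sub>R e i)" by simp
  then show ?thesis
    using assms(3,4) by (simp add: linear_sum linear_scale)
qed

text \<open>Expanding in the standard basis confines the frame to the product
  \<open>E ** transpose E\<close>, which is the inverse Gram matrix when the frame is
  orthonormal.\<close>

lemma sum_frame:
  fixes b :: "'e::real_vector \<Rightarrow> 'e \<Rightarrow> real" and L :: "real^'n \<Rightarrow> 'e"
  assumes "bilinear b" "linear L"
  shows "(\<Sum>i\<in>UNIV. b (L (e i)) (L (e i))) =
    (\<Sum>j\<in>UNIV. \<Sum>k\<in>UNIV. (frame_matrix e ** transpose (frame_matrix e)) $ j $ k *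
      b (L (axis j 1)) (L (axis k 1)))"
proof -
  have "(\<Sum>i\<in>UNIV. b (L (e i)) (L (e i))) =
      (\<Sum>i\<in>UNIV. \<Sum>j\<in>UNIV. \<Sum>k\<in>UNIV. e i $ j * e i $ k * b (L (axis j 1)) (L (axis k 1)))"
    by (intro sum.cong refl bilinear_axis_expansion[OF assms])
  also have "\<dots> = (\<Sum>j\<in>UNIV. \<Sum>i\<in>UNIV. \<Sum>k\<in>UNIV. e i $ j * e i $ k * b (L (axis j 1)) (L (axis k 1)))"
    by (rule sum.swap)
  also have "\<dots> = (\<Sum>j\<in>UNIV. \<Sum>k\<in>UNIV. \<Sum>i\<in>UNIV. e i $ j * e i $ k * b (L (axis j 1)) (L (axis k 1)))"
    by (intro sum.cong refl sum.swap)
  finally show ?thesis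
    by (simp add: matrix_matrix_mult_def transpose_def frame_matrix_def sum_distrib_right)
qed

definition inner_form :: "(real^'n \<Rightarrow> real^'n \<Rightarrow> real) \<Rightarrow> bool" where
  "inner_form a \<longleftrightarrow> bilinear a \<and> (\<forall>v w. a v w = a w v) \<and> (\<forall>v. v \<noteq> 0 \<longrightarrow> a v v > 0)"

text \<open>A largest orthonormal set is a basis: otherwise subtracting from a vector outside its span
  the projection onto the span enlarges it.\<close>

lemma ex_orthonormal_frame:
  fixes a :: "real^'n::finite \<Rightarrow> real^'n \<Rightarrow> real"
  assumes "inner_form a"
  shows "\<exists>e. orthonormal_frame a e"
proof -
  have bil: "bilinear a" and sym: "\<And>v w. a v w = a w v" and pos: "\<And>v. v \<noteq> 0 \<Longrightarrow> a v v > 0"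
    using assms by (auto simp: inner_form_def)
  define ON where "ON = {S :: (real^'n) set. finite S \<and> (\<forall>v\<in>S. \<forall>w\<in>S. a v w = (if v = w then 1 else 0))}"
  have lin: "linear (\<lambda>v. a v w)" "linear (a w)" for w
    using bil by (auto simp: bilinear_def)
  have indep: "independent S" if "S \<in> ON" for S
  proof (rule independent_if_scalars_zero)
    show "finite S" using that by (simp add: ON_def)
    fix c v assume 0: "(\<Sum>x\<in>S. c x *\<^sub>R x) = 0" and v: "v \<in> S"
    have "0 = a (\<Sum>x\<in>S. c x *\<^sub>R x) v" using 0 linear_0[OF lin(1)[of v]] by simp
    also have "\<dots> = (\<Sum>x\<in>S. c x * a x v)"
      by (simp add: linear_sum[OF lin(1)] linear_scale[OF lin(1)])
    also have "\<dots> = (\<Sum>x\<in>S. if x = v then c x else 0)"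
      using that v by (intro sum.cong) (auto simp: ON_def)
    also have "\<dots> = c v" using that v by (simp add: ON_def)
    finally show "c v = 0" by simp
  qed
  have bound: "card S \<le> CARD('n)" if "S \<in> ON" for S
    using independent_bound[OF indep[OF that]] by (simp add: DIM_cart)
  have "{} \<in> ON" by (simp add: ON_def)
  then obtain S where S: "S \<in> ON" and max: "\<And>T. T \<in> ON \<Longrightarrow> card T \<le> card S"
    using ex_has_greatest_nat[of "\<lambda>S. S \<in> ON" "{}" card "Suc CARD('n)"] bound
    by (metis le_imp_less_Suc)
  have fin: "finite S" using S by (simp add: ON_def)
  have "card S = CARD('n)"
  proof (rule ccontr)
    assume "card S \<noteq> CARD('n)"
    then have "card S < dim (UNIV :: (real^'n) set)"
      using bound[OF S] by (simp add: dim_UNIV DIM_cart)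
    then have "span S \<noteq> UNIV"
      using dim_le_card'[OF fin] dim_span[of S] by (metis leD)
    then obtain v where v: "v \<notin> span S" by auto
    define w where "w = v - (\<Sum>x\<in>S. a v x *\<^sub>R x)"
    have "w \<notin> span S"
    proof
      assume "w \<in> span S"
      moreover have "(\<Sum>x\<in>S. a v x *\<^sub>R x) \<in> span S"
        by (intro span_sum span_scale span_base)
      ultimately show False
        using v span_add[of w S "\<Sum>x\<in>S. a v x *\<^sub>R x"] by (simp add: w_def)
    qed
    then have "w \<noteq> 0" using span_zero by metis
    have orth: "a w x = 0" if "x \<in> S" for x
    proof -
      have "a w x = a v x - (\<Sum>y\<in>S. a v y * a y x)"
        by (simp add: w_def linear_diff[OF lin(1)] linear_sum[OF lin(1)] linear_scale[OF lin(1)])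
      also have "(\<Sum>y\<in>S. a v y * a y x) = (\<Sum>y\<in>S. if y = x then a v x else 0)"
        using that S by (intro sum.cong) (auto simp: ON_def)
      finally show ?thesis using that fin by simp
    qed
    define z where "z = (1 / sqrt (a w w)) *\<^sub>R w"
    have "a z z = 1"
      using pos[OF \<open>w \<noteq> 0\<close>]
      by (simp add: z_def linear_scale[OF lin(1)] linear_scale[OF lin(2)] real_div_sqrt)
    moreover have "a z x = 0" if "x \<in> S" for x
      using orth[OF that] by (simp add: z_def linear_scale[OF lin(1)])
    moreover have "a x z = 0" if "x \<in> S" for x
      using calculation(2)[OF that] sym[of x z] by metis
    moreover have "z \<notin> S"
      using calculation(1,2) zero_neq_one by metis
    ultimately have "insert z S \<in> ON" "z \<notin> S"
      using S unfolding ON_def mem_Collect_eq by (metis finite_insert insert_iff)+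
    then show False using max[of "insert z S"] fin by simp
  qed
  then obtain e where e: "bij_betw e (UNIV :: 'n set) S"
    using fin finite_same_card_bij[of "UNIV :: 'n set" S] by auto
  have "orthonormal_frame a e"
    using e S by (auto simp: orthonormal_frame_def ON_def bij_betw_def inj_def)
  then show ?thesis by blast
qed

text \<open>The frame picked by \<open>SOME\<close> may be exchanged for any other: both products of
  a frame matrix with its transpose invert the same Gram matrix, and inverses are unique.\<close>

lemma hs_norm_sq_eq:
  fixes a :: "real^'n::finite \<Rightarrow> real^'n \<Rightarrow> real" and b :: "'e::real_vector \<Rightarrow> 'e \<Rightarrow> real"
  assumes a: "bilinear a" and e: "orthonormal_frame a e" and b: "bilinear b" and L: "linear L"
  shows "hs_norm_sq a b L = (\<Sum>i\<in>UNIV. b (L (e i)) (L (e i)))"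
proof -
  define f where "f = (SOME e. orthonormal_frame a e)"
  have f: "orthonormal_frame a f"
    unfolding f_def by (rule someI[of _ e]) (fact e)
  let ?X = "\<lambda>e. frame_matrix e ** transpose (frame_matrix e)"
  have "?X f = (?X e ** gram a) ** ?X f"
    using frame_matrix_inverse_gram[OF a e] matrix_left_right_inverse[of "gram a" "?X e"] by simp
  also have "\<dots> = ?X e ** (gram a ** ?X f)"
    by (simp add: matrix_mul_assoc)
  also have "\<dots> = ?X e"
    using frame_matrix_inverse_gram[OF a f] by simp
  finally show ?thesis
    unfolding hs_norm_sq_def f_def[symmetric] Let_def sum_frame[OF b L] by simp
qed

text \<open>Taking determinants in \<open>gram_frame\<close> shows that \<open>det (gram a)\<close>
  times a square equals 1.\<close>

lemma det_gram_pos: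
  fixes a :: "real^'n::finite \<Rightarrow> real^'n \<Rightarrow> real"
  assumes "inner_form a"
  shows "det (gram a) > 0"
proof -
  obtain e where e: "orthonormal_frame a e" using ex_orthonormal_frame[OF assms] ..
  have "det (frame_matrix e) * det (gram a) * det (frame_matrix e) = 1"
    using arg_cong[OF gram_frame[OF _ e], of det] assms by (simp add: det_mul inner_form_def)
  then have "det (gram a) * (det (frame_matrix e))\<^sup>2 = 1"
    by (simp add: power2_eq_square mult_ac)
  then show ?thesis
    by (metis not_le zero_le_power2 zero_less_one zero_less_mult_pos2 zero_less_power2 mult_zero_right zero_neq_one power_zero_numeral)
qed

text \<open>By Cramer's rule this is the inverse of \<open>M\<close>.\<close>

definition cramer_inv :: "real^'n^'n \<Rightarrow> real^'n^'n" where
  "cramer_inv M = (\<chi> k j. det (\<chi> i l. if l = k then axis j 1 $ i else M $ i $ l) / det M)"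

lemma cramer_inv_eq:
  assumes "M ** X = mat 1"
  shows "X = cramer_inv M"
proof -
  have "det M \<noteq> 0"
    using assms invertible_det_nz invertible_right_inverse by blast
  moreover have "M *v column j X = axis j 1" for j
  proof -
    have "M *v column j X = (M ** X) *v axis j 1"
      by (metis matrix_vector_mul_assoc matrix_vector_mult_basis)
    then show ?thesis using assms by simp
  qed
  ultimately have "column j X = (\<chi> k. det (\<chi> i l. if l = k then axis j 1 $ i else M $ i $ l) / det M)" for j
    using cramer by blast
  then show ?thesis
    by (simp add: cramer_inv_def vec_eq_iff column_def)
qed

text \<open>No chosen frame is left in this formula, and its coefficients are quotients of
  polynomials in the Gram entries. Continuity of the energy density is read off from it.\<close>

lemma hs_norm_sq_cramer:
  fixes a :: "real^'n::finite \<Rightarrow> real^'n \<Rightarrow> real" and b :: "'e::real_vector \<Rightarrow> 'e \<Rightarrow> real"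
  assumes "inner_form a" "bilinear b" "linear L"
  shows "hs_norm_sq a b L = (\<Sum>j\<in>UNIV. \<Sum>k\<in>UNIV. cramer_inv (gram a) $ j $ k *
      b (L (axis j 1)) (L (axis k 1)))"
proof -
  have a: "bilinear a" using assms(1) by (simp add: inner_form_def)
  obtain e where e: "orthonormal_frame a e" using ex_orthonormal_frame[OF assms(1)] ..
  show ?thesis
    unfolding hs_norm_sq_eq[OF a e assms(2,3)] sum_frame[OF assms(2,3)]
    by (simp add: cramer_inv_eq[OF frame_matrix_inverse_gram[OF a e]])
qed

lemma continuous_on_det:
  fixes M :: "'a::topological_space \<Rightarrow> real^'n^'n"
  assumes "\<And>i j. continuous_on S (\<lambda>x. M x $ i $ j)"
  shows "continuous_on S (\<lambda>x. det (M x))"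
  unfolding det_def by (intro continuous_intros assms)

lemma continuous_on_cramer_inv:
  fixes M :: "'a::topological_space \<Rightarrow> real^'n^'n"
  assumes "\<And>i j. continuous_on S (\<lambda>x. M x $ i $ j)" "\<And>x. x \<in> S \<Longrightarrow> det (M x) \<noteq> 0"
  shows "continuous_on S (\<lambda>x. cramer_inv (M x) $ i $ j)"
proof -
  have "continuous_on S (\<lambda>x. (\<chi> k l. if l = i then axis j 1 $ k else M x $ k $ l) $ k' $ l')" for k' l'
    using assms(1) by (cases "l' = i") simp_all
  then show ?thesis
    unfolding cramer_inv_def using assms
    by (simp, intro continuous_on_divide continuous_on_det) auto
qed

section \<open>The Riemannian volume\<close>

lemma set_nn_integral_absolutely_integrable:
  fixes f :: "'a::euclidean_space \<Rightarrow> real"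
  assumes f: "set_borel_measurable borel S f" "\<And>x. x \<in> S \<Longrightarrow> 0 \<le> f x"
    and fin: "(\<integral>\<^sup>+x\<in>S. f x \<partial>lborel) < \<infinity>"
  shows "f absolutely_integrable_on S"
proof -
  have "set_integrable lborel S f"
    unfolding set_integrable_def
  proof (rule integrableI_nonneg)
    show "(\<lambda>x. indicat_real S x *\<^sub>R f x) \<in> borel_measurable lborel"
      using f(1) by (simp add: set_borel_measurable_def)
    show "AE x in lborel. 0 \<le> indicat_real S x *\<^sub>R f x"
      using f(2) by (intro AE_I2) (auto simp: indicator_def)
    have "(\<integral>\<^sup>+x. ennreal (indicat_real S x *\<^sub>R f x) \<partial>lborel) = (\<integral>\<^sup>+x\<in>S. f x \<partial>lborel)"
      by (intro nn_integral_cong) (auto simp: indicator_def)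
    then show "(\<integral>\<^sup>+x. ennreal (indicat_real S x *\<^sub>R f x) \<partial>lborel) < \<infinity>"
      using fin by simp
  qed
  then show ?thesis
    by (simp add: set_integrable_def integrable_completion)
qed

lemma set_nn_integral_absolutely_integrable_eq:
  fixes f :: "'a::euclidean_space \<Rightarrow> real"
  assumes "\<And>x. x \<in> S \<Longrightarrow> 0 \<le> f x" "f absolutely_integrable_on S"
  shows "(\<integral>\<^sup>+x\<in>S. f x \<partial>lborel) = ennreal (integral S f)"
  using assms by (intro nn_integral_has_integral_lebesgue')
    (auto simp: absolutely_integrable_on_def intro: integrable_integral)

text \<open>Change of variables for absolutely integrable functions becomes an equality of extended
  nonnegative integrals: either both functions are integrable with equal integrals, or neither is
  and both sides are infinite.\<close>

lemma nn_integral_change_of_variables: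
  fixes f :: "real^'n::{finite,wellorder} \<Rightarrow> real" and g :: "real^'n::_ \<Rightarrow> real^'n::_"
  assumes S: "S \<in> sets borel" and der: "\<And>x. x \<in> S \<Longrightarrow> (g has_derivative g' x) (at x within S)"
    and inj: "inj_on g S"
    and F: "set_borel_measurable borel (g ` S) F" "\<And>x. x \<in> g ` S \<Longrightarrow> 0 \<le> F x"
    and f: "set_borel_measurable borel S f"
    and eq: "\<And>x. x \<in> S \<Longrightarrow> f x = \<bar>det (matrix (g' x))\<bar> * F (g x)"
  shows "(\<integral>\<^sup>+x\<in>S. f x \<partial>lborel) = (\<integral>\<^sup>+y\<in>g ` S. F y \<partial>lborel)"
proof -
  have f0: "0 \<le> f x" if "x \<in> S" for x
    using that F(2) eq by auto
  \<comment> \<open>The change of variables rule is stated for vector-valued functions;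
    \<open>vec\<close> embeds the real values into \<open>real^1\<close>, and the equivalence is
    translated back below.\<close>
  have "(\<lambda>x. \<bar>det (matrix (g' x))\<bar> *\<^sub>R vec (F (g x)) :: real^1) absolutely_integrable_on S \<and>
        integral S (\<lambda>x. \<bar>det (matrix (g' x))\<bar> *\<^sub>R vec (F (g x))) = (vec b :: real^1)
      \<longleftrightarrow> (\<lambda>x. vec (F x) :: real^1) absolutely_integrable_on g ` S \<and>
        integral (g ` S) (\<lambda>x. vec (F x)) = (vec b :: real^1)" for b
    using S der inj by (intro has_absolute_integral_change_of_variables) auto
  moreover have "\<bar>det (matrix (g' x))\<bar> *\<^sub>R (vec (F (g x)) :: real^1) = vec (f x)" if "x \<in> S" for x
    using that eq by (simp add: vec_eq_iff)
  then have "(\<lambda>x. \<bar>det (matrix (g' x))\<bar> *\<^sub>R vec (F (g x)) :: real^1) absolutely_integrable_on S \<longleftrightarrow>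
        (\<lambda>x. vec (f x) :: real^1) absolutely_integrable_on S"
      "integral S (\<lambda>x. \<bar>det (matrix (g' x))\<bar> *\<^sub>R vec (F (g x)) :: real^1) =
        integral S (\<lambda>x. vec (f x))"
    by (intro set_integrable_cong integral_cong refl; simp)+
  ultimately have *: "f absolutely_integrable_on S \<and> integral S f = b
      \<longleftrightarrow> F absolutely_integrable_on g ` S \<and> integral (g ` S) F = b" for b
    by (simp add: absolutely_integrable_on_1_iff integral_on_1_eq)
  show ?thesis
  proof (cases "f absolutely_integrable_on S")
    case True
    then show ?thesis
      using * f0 F(2) set_nn_integral_absolutely_integrable_eq[of S f]
        set_nn_integral_absolutely_integrable_eq[of "g ` S" F] by metis
  next
    case False
    then have "\<not> F absolutely_integrable_on g ` S" using * by blast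
    with False show ?thesis
      using set_nn_integral_absolutely_integrable[OF f f0]
        set_nn_integral_absolutely_integrable[OF F] by (metis infinity_ennreal_def less_top)
  qed
qed

section \<open>Charts, transition maps and the volume density\<close>

locale compact_riemannian =
  fixes A :: "('m::{t2_space,second_countable_topology}, 'n::{finite,wellorder}) chart set"
    and h :: "('m, 'n) metric"
  assumes atlas: "smooth_atlas A"
    and metric: "riemannian_metric A h"
    and compact: "compact (UNIV :: 'm set)"
begin

lemma chart_at: obtains C where "C \<in> A" "p \<in> fst C"
  using atlas unfolding smooth_atlas_def by blast

lemma chart_open [simp]:
  assumes "C \<in> A" shows "open (fst C)" "open (snd C ` fst C)"
  using atlas assms unfolding smooth_atlas_def by blast+

lemma chart_homeo: "C \<in> A \<Longrightarrow> homeomorphism (fst C) (snd C ` fst C) (snd C) (chart_inv C)"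
  using atlas unfolding smooth_atlas_def by blast

lemma chart_inv_chart [simp]: "C \<in> A \<Longrightarrow> p \<in> fst C \<Longrightarrow> chart_inv C (snd C p) = p"
  using chart_homeo[of C] by (simp add: homeomorphism_def)

lemma continuous_on_chart: "C \<in> A \<Longrightarrow> continuous_on (fst C) (snd C)"
  and continuous_on_chart_inv: "C \<in> A \<Longrightarrow> continuous_on (snd C ` fst C) (chart_inv C)"
  using chart_homeo[of C] by (simp_all add: homeomorphism_def)

lemma chart_image_eq:
  assumes "C \<in> A" "B \<subseteq> fst C"
  shows "snd C ` B = {x \<in> snd C ` fst C. chart_inv C x \<in> B}"
  using assms by force

lemma open_chart_image:
  assumes C: "C \<in> A" and B: "open B" "B \<subseteq> fst C"
  shows "open (snd C ` B)"
proof -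
  have "snd C ` B = snd C ` fst C \<inter> chart_inv C -` B"
    using chart_image_eq[OF C B(2)] by blast
  then show ?thesis
    using continuous_open_preimage[OF continuous_on_chart_inv[OF C] chart_open(2)[OF C] B(1)] by simp
qed

text \<open>Inside a chart an image under \<open>snd C\<close> is a preimage under the continuous
  map \<open>chart_inv C\<close>.\<close>

lemma borel_chart_image:
  assumes C: "C \<in> A" and B: "B \<in> sets borel" "B \<subseteq> fst C"
  shows "snd C ` B \<in> sets borel"
proof -
  let ?V = "snd C ` fst C"
  have "chart_inv C \<in> borel_measurable (restrict_space borel ?V)"
    by (intro borel_measurable_continuous_on_restrict continuous_on_chart_inv C)
  then have "chart_inv C -` B \<inter> ?V \<in> sets (restrict_space borel ?V)"
    using measurable_sets[OF _ B(1), of "chart_inv C"] by (metis space_restrict_space2 borel_open C chart_open(2))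
  then have "chart_inv C -` B \<inter> ?V \<in> sets borel"
    using C by (simp add: sets_restrict_space_iff)
  moreover have "snd C ` B = chart_inv C -` B \<inter> ?V"
    using chart_image_eq[OF C B(2)] by auto
  ultimately show ?thesis by simp
qed

lemma inner_form_metric:
  assumes "C \<in> A" "p \<in> fst C"
  shows "inner_form (h C p)"
  using metric assms unfolding riemannian_metric_def inner_form_def by blast

lemma transition_has_derivative:
  assumes "C \<in> A" "D \<in> A" "p \<in> fst C" "p \<in> fst D"
  shows "(transition C D has_derivative frechet_derivative (transition C D) (at (snd C p)))
    (at (snd C p))"
proof -
  have "Ck_on (Suc 0) (transition C D) (snd C ` (fst C \<inter> fst D))"
    using atlas assms unfolding smooth_atlas_def smooth_on_def by blast
  from Ck_on_has_derivative[OF this] show ?thesis using assms by simp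
qed

lemma continuous_on_metric:
  assumes "C \<in> A"
  shows "continuous_on (fst C) (\<lambda>p. h C p v w)"
proof -
  have "Ck_on 0 (\<lambda>x. h C (chart_inv C x) v w) (snd C ` fst C)"
    using metric assms unfolding riemannian_metric_def smooth_on_def by blast
  then have "continuous_on (snd C ` fst C) (\<lambda>x. h C (chart_inv C x) v w)" by simp
  then have "continuous_on (fst C) (\<lambda>p. h C (chart_inv C (snd C p)) v w)"
    by (rule continuous_on_compose2[OF _ continuous_on_chart[OF assms]]) simp
  then show ?thesis using assms by (simp cong: continuous_on_cong)
qed

lemma volume_density_gram: "volume_density h C p = sqrt (det (gram (h C p)))"
  by (simp add: volume_density_def gram_def)

lemma volume_density_pos:
  assumes "C \<in> A" "p \<in> fst C"
  shows "volume_density h C p > 0"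
  using det_gram_pos[OF inner_form_metric[OF assms]] by (simp add: volume_density_gram)

lemma continuous_on_volume_density:
  assumes "C \<in> A"
  shows "continuous_on (snd C ` fst C) (\<lambda>x. volume_density h C (chart_inv C x))"
proof -
  have "continuous_on (fst C) (\<lambda>p. volume_density h C p)"
    unfolding volume_density_gram
    by (intro continuous_on_real_sqrt continuous_on_det)
      (use continuous_on_metric[OF assms] in \<open>simp add: gram_def\<close>)
  then show ?thesis
    by (rule continuous_on_compose2[OF _ continuous_on_chart_inv[OF assms]]) (use assms in auto)
qed

text \<open>The Gram matrix changes by congruence with the Jacobian matrix, so its determinant gains
  the square of the Jacobian determinant and the root gains the absolute value.\<close>

lemma volume_density_transition:
  assumes "C \<in> A" "D \<in> A" "p \<in> fst C" "p \<in> fst D"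
  shows "volume_density h C p =
    \<bar>det (matrix (frechet_derivative (transition C D) (at (snd C p))))\<bar> * volume_density h D p"
proof -
  let ?T = "frechet_derivative (transition C D) (at (snd C p))"
  have T: "linear ?T"
    using transition_has_derivative[OF assms] by (simp add: has_derivative_linear)
  have "h C p = (\<lambda>v w. h D p (?T v) (?T w))"
    using metric assms unfolding riemannian_metric_def by (intro ext) blast
  moreover have "bilinear (h D p)"
    using inner_form_metric assms by (auto simp: inner_form_def)
  ultimately have "gram (h C p) = transpose (matrix ?T) ** gram (h D p) ** matrix ?T"
    using gram_pullback[OF _ T] by metis
  then have "det (gram (h C p)) = (det (matrix ?T))\<^sup>2 * det (gram (h D p))"
    by (simp add: det_mul power2_eq_square mult_ac)
  then show ?thesis
    by (simp add: volume_density_gram real_sqrt_mult)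
qed

text \<open>The value that \<open>riemannian_volume\<close> prescribes for Borel sets inside the
  domain of \<open>C\<close>.\<close>

definition chart_volume :: "('m, 'n) chart \<Rightarrow> 'm set \<Rightarrow> ennreal" where
  "chart_volume C B =
     (\<integral>\<^sup>+x\<in>snd C ` B. ennreal (volume_density h C (chart_inv C x)) \<partial>lborel)"

lemma set_borel_measurable_volume_density:
  assumes C: "C \<in> A" and B: "B \<in> sets borel" "B \<subseteq> fst C"
  shows "set_borel_measurable borel (snd C ` B) (\<lambda>x. volume_density h C (chart_inv C x))"
proof -
  have "set_borel_measurable borel (snd C ` fst C) (\<lambda>x. volume_density h C (chart_inv C x))"
    using C by (intro borel_measurable_continuous_on_indicator continuous_on_volume_density
        set_measurable_continuous_on) auto
  then show ?thesis
    by (rule set_borel_measurable_subset) (use borel_chart_image[OF C B] B in auto)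
qed

text \<open>The factor by which the density changes is exactly the Jacobian factor of the
  substitution. This consistency is what allows the volumes of different charts to be glued.\<close>

lemma chart_volume_transition:
  assumes C: "C \<in> A" and D: "D \<in> A" and B: "B \<in> sets borel" "B \<subseteq> fst C" "B \<subseteq> fst D"
  shows "chart_volume C B = chart_volume D B"
proof -
  let ?S = "snd C ` B"
  have im: "transition C D ` ?S = snd D ` B"
    using C B by (force simp: transition_def)
  have "chart_volume C B = (\<integral>\<^sup>+y\<in>transition C D ` ?S.
      ennreal (volume_density h D (chart_inv D y)) \<partial>lborel)"
    unfolding chart_volume_def
  proof (rule nn_integral_change_of_variables[where g' = "\<lambda>x. frechet_derivative (transition C D) (at x)"])
    show "?S \<in> sets borel" by (rule borel_chart_image) fact+
    show "(transition C D has_derivative frechet_derivative (transition C D) (at x)) (at x within ?S)"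
      if "x \<in> ?S" for x
    proof -
      obtain p where p: "p \<in> fst C" "p \<in> fst D" "x = snd C p"
        using \<open>x \<in> ?S\<close> B(2,3) by blast
      show ?thesis
        unfolding p(3) by (rule has_derivative_at_withinI) (rule transition_has_derivative[OF C D p(1,2)])
    qed
    show "inj_on (transition C D) ?S"
    proof (rule inj_onI)
      fix x y assume "x \<in> ?S" "y \<in> ?S" "transition C D x = transition C D y"
      then obtain p q where pq: "p \<in> B" "q \<in> B" "x = snd C p" "y = snd C q" by blast
      with \<open>transition C D x = transition C D y\<close> have "snd D p = snd D q"
        using C B by (auto simp: transition_def subset_iff)
      then show "x = y" using pq D B by (metis chart_inv_chart subset_iff)
    qed
    show "set_borel_measurable borel (transition C D ` ?S) (\<lambda>y. volume_density h D (chart_inv D y))"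
      unfolding im by (rule set_borel_measurable_volume_density) fact+
    show "0 \<le> volume_density h D (chart_inv D y)" if "y \<in> transition C D ` ?S" for y
      using that D B volume_density_pos[of D] unfolding im by (force simp: less_imp_le)
    show "set_borel_measurable borel ?S (\<lambda>x. volume_density h C (chart_inv C x))"
      by (rule set_borel_measurable_volume_density) fact+
    show "volume_density h C (chart_inv C x) = \<bar>det (matrix (frechet_derivative (transition C D) (at x)))\<bar> *
        volume_density h D (chart_inv D (transition C D x))" if "x \<in> ?S" for x
      using that C D B volume_density_transition[OF C D] by (auto simp: transition_def subset_iff)
  qed
  then show ?thesis by (simp add: im chart_volume_def)
qed

lemma chart_volume_suminf:
  assumes C: "C \<in> A" and B: "range B \<subseteq> sets borel" "\<And>i. B i \<subseteq> fst C" "disjoint_family B"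
  shows "(\<Sum>i. chart_volume C (B i)) = chart_volume C (\<Union>i. B i)" (is "_ = chart_volume C ?U")
proof -
  \<comment> \<open>The density is known to be measurable only on the chart image. The indicator
    makes it a Borel function on the whole space, and countable additivity comes from the measure
    with this density.\<close>
  let ?f = "\<lambda>x. ennreal (volume_density h C (chart_inv C x) * indicator (snd C ` fst C) x)"
  have meas: "(\<lambda>x. volume_density h C (chart_inv C x) * indicator (snd C ` fst C) x) \<in> borel_measurable borel"
    using set_borel_measurable_volume_density[OF C _ subset_refl] C
    by (simp add: set_borel_measurable_def mult.commute)
  have eq: "chart_volume C X = emeasure (density lborel ?f) (snd C ` X)"
    if "X \<in> sets borel" "X \<subseteq> fst C" for X
  proof -
    have "emeasure (density lborel ?f) (snd C ` X) = (\<integral>\<^sup>+x\<in>snd C ` X. ?f x \<partial>lborel)"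
      using meas borel_chart_image[OF C that] by (intro emeasure_density) auto
    also have "\<dots> = chart_volume C X"
      unfolding chart_volume_def using that by (intro nn_integral_cong) (auto simp: indicator_def)
    finally show ?thesis ..
  qed
  have "disjoint_family (\<lambda>i. snd C ` B i)"
    unfolding disjoint_family_on_def
  proof safe
    fix i j p q assume "i \<noteq> j" "p \<in> B i" "q \<in> B j" "snd C p = snd C q"
    then show "snd C p \<in> {}"
      using C B(2,3) by (metis chart_inv_chart disjoint_family_onD disjoint_iff iso_tuple_UNIV_I subset_iff)
  qed
  then have "(\<Sum>i. emeasure (density lborel ?f) (snd C ` B i)) =
      emeasure (density lborel ?f) (\<Union>i. snd C ` B i)"
    using borel_chart_image[OF C] B by (intro suminf_emeasure) auto
  moreover have "?U \<in> sets borel" "?U \<subseteq> fst C" using B by auto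
  ultimately show ?thesis
    using eq[of ?U] eq[of "B i" for i] B(1,2) by (simp add: image_UN range_subsetD)
qed

section \<open>Gluing the chart volumes to one measure\<close>

lemma ex_chart_sequence:
  obtains F :: "nat \<Rightarrow> ('m, 'n) chart" where "range F \<subseteq> A" "(\<Union>i. fst (F i)) = UNIV"
proof -
  have "\<And>S. S \<in> fst ` A \<Longrightarrow> open S" "\<Union>(fst ` A) = UNIV"
    using chart_open(1) atlas unfolding smooth_atlas_def by blast+
  then obtain \<F> where "\<F> \<subseteq> fst ` A" "countable \<F>" "\<Union>\<F> = UNIV"
    using Lindelof by metis
  then obtain G where G: "G \<subseteq> A" "countable G" "\<Union>(fst ` G) = UNIV"
    by (metis countable_subset_image)
  \<comment> \<open>A type is inhabited, so a cover of it has a member; \<open>from_nat_into\<close>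
    enumerates only nonempty countable sets.\<close>
  then have "G \<noteq> {}" by auto
  then have "range (from_nat_into G) = G"
    using G(2) by (rule range_from_nat_into)
  then show ?thesis
    using G that[of "from_nat_into G"] by (metis image_image)
qed

definition is_volume :: "'m measure \<Rightarrow> bool" where
  "is_volume \<mu> \<longleftrightarrow> sets \<mu> = sets borel \<and>
     (\<forall>C\<in>A. \<forall>B\<in>sets borel. B \<subseteq> fst C \<longrightarrow> emeasure \<mu> B = chart_volume C B)"

text \<open>Without this the definite description in \<open>riemannian_volume\<close> says nothing.
  A countable chart cover is cut into disjoint Borel pieces, each measured in its own chart; any
  competing measure agrees on every part of such a piece, hence everywhere.\<close>

lemma ex1_volume: "\<exists>!\<mu>. is_volume \<mu>"
proof -
  obtain F :: "nat \<Rightarrow> ('m, 'n) chart" where F: "range F \<subseteq> A" "(\<Union>i. fst (F i)) = (UNIV :: 'm set)"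
    by (rule ex_chart_sequence)
  have FA: "F i \<in> A" for i using F(1) by auto
  define D where "D = disjointed (\<lambda>i. fst (F i))"
  have D: "D i \<in> sets borel" "D i \<subseteq> fst (F i)" for i
  proof -
    have "range (\<lambda>i. fst (F i)) \<subseteq> sets borel" using FA by auto
    then show "D i \<in> sets borel" unfolding D_def
      using sets.range_disjointed_sets[of "\<lambda>i. fst (F i)" borel] by auto
    show "D i \<subseteq> fst (F i)" unfolding D_def by (rule disjointed_subset)
  qed
  have disj: "disjoint_family D" and cover: "(\<Union>i. D i) = UNIV"
    using F(2) by (simp_all add: D_def disjoint_family_disjointed UN_disjointed_eq)
  have disj_Int: "disjoint_family (\<lambda>i. B \<inter> D i)" for B
    using disj unfolding disjoint_family_on_def by blast
  define \<nu> where "\<nu> B = (\<Sum>i. chart_volume (F i) (B \<inter> D i))" for B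
  define \<mu> where "\<mu> = measure_of UNIV (sets borel) \<nu>"
  have sub: "chart_volume C {} = 0" for C by (simp add: chart_volume_def)
  have "countably_additive (sets borel) \<nu>"
    unfolding countably_additive_def
  proof (intro allI impI)
    fix B :: "nat \<Rightarrow> 'm set"
    assume B: "range B \<subseteq> sets borel" "disjoint_family B" "(\<Union>i. B i) \<in> sets borel"
    \<comment> \<open>One of the two series is read as an integral over counting measure, so that
      the two can be exchanged.\<close>
    have "(\<Sum>n. \<nu> (B n)) =
        (\<Sum>n. \<integral>\<^sup>+i. chart_volume (F i) (B n \<inter> D i) \<partial>count_space UNIV)"
      by (simp add: \<nu>_def nn_integral_count_space_nat)
    also have "\<dots> = (\<integral>\<^sup>+i. (\<Sum>n. chart_volume (F i) (B n \<inter> D i)) \<partial>count_space UNIV)"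
      by (rule nn_integral_suminf[symmetric]) simp
    also have "\<dots> = (\<Sum>i. \<Sum>n. chart_volume (F i) (B n \<inter> D i))"
      by (rule nn_integral_count_space_nat)
    also have "\<dots> = (\<Sum>i. chart_volume (F i) (\<Union>n. B n \<inter> D i))"
      using B D(1) by (intro suminf_cong chart_volume_suminf FA)
        (auto simp: disjoint_family_on_def dest: subsetD[OF D(2)])
    also have "\<dots> = \<nu> (\<Union>n. B n)" by (simp add: \<nu>_def)
    finally show "(\<Sum>n. \<nu> (B n)) = \<nu> (\<Union>n. B n)" .
  qed
  moreover have "positive (sets borel) \<nu>"
    by (simp add: positive_def \<nu>_def sub)
  moreover have "sigma_algebra (UNIV :: 'm set) (sets borel)"
    by (metis sets.sigma_algebra_axioms space_borel)
  ultimately have em: "emeasure \<mu> B = \<nu> B" if "B \<in> sets borel" for B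
    unfolding \<mu>_def using that by (intro emeasure_measure_of_sigma)
  have split: "emeasure M B = (\<Sum>i. emeasure M (B \<inter> D i))" if "sets M = sets borel" "B \<in> sets borel" for M B
  proof -
    have "(\<Sum>i. emeasure M (B \<inter> D i)) = emeasure M (\<Union>i. B \<inter> D i)"
      using that D(1) by (intro suminf_emeasure disj_Int) auto
    then show ?thesis using cover by (simp flip: Int_UN_distrib)
  qed
  have sets: "sets \<mu> = sets borel"
    unfolding \<mu>_def by (metis sets.sets_measure_of_eq space_borel)
  have vol: "is_volume \<mu>"
    unfolding is_volume_def
  proof (intro conjI ballI impI)
    fix C B assume C: "C \<in> A" and B: "B \<in> sets borel" "B \<subseteq> fst C"
    \<comment> \<open>Each \<open>B \<inter> D i\<close> lies in the domains of both
      \<open>F i\<close> and \<open>C\<close>, so every summand may be computed in the single chart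
      \<open>C\<close>.\<close>
    have "emeasure \<mu> B = (\<Sum>i. chart_volume C (B \<inter> D i))"
      unfolding em[OF B(1)] \<nu>_def using B D
      by (intro suminf_cong chart_volume_transition FA C) (auto intro: sets.Int)
    also have "\<dots> = chart_volume C (\<Union>i. B \<inter> D i)"
      using B D(1) by (intro chart_volume_suminf disj_Int C) auto
    also have "\<dots> = chart_volume C B" using cover by (simp flip: Int_UN_distrib)
    finally show "emeasure \<mu> B = chart_volume C B" .
  qed (rule sets)
  moreover have "M = \<mu>" if "is_volume M" for M
  proof (rule measure_eqI)
    have M: "sets M = sets borel" using that by (simp add: is_volume_def)
    then show "sets M = sets \<mu>" by (simp add: sets)
    fix B assume "B \<in> sets M"
    then have B: "B \<in> sets borel" using M by simp
    have "emeasure M (B \<inter> D i) = emeasure \<mu> (B \<inter> D i)" for i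
    proof -
      have "B \<inter> D i \<in> sets borel" "B \<inter> D i \<subseteq> fst (F i)" using B D by auto
      then show ?thesis using that vol FA unfolding is_volume_def by metis
    qed
    then show "emeasure M B = emeasure \<mu> B"
      using split[OF M B] split[OF sets B] by simp
  qed
  ultimately show ?thesis by blast
qed

section \<open>Positivity, finiteness and integration\<close>

abbreviation "vol \<equiv> riemannian_volume A h"

lemma is_volume_vol: "is_volume vol"
proof -
  have "vol = (THE \<mu>. is_volume \<mu>)"
    by (simp add: riemannian_volume_def is_volume_def chart_volume_def)
  then show ?thesis using theI'[OF ex1_volume] by simp
qed

lemma sets_vol [simp, measurable_cong]: "sets vol = sets borel"
  using is_volume_vol by (simp add: is_volume_def)

lemma space_vol [simp]: "space vol = UNIV"
  using sets_eq_imp_space_eq[OF sets_vol] by simp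

lemma emeasure_vol_chart:
  "C \<in> A \<Longrightarrow> B \<in> sets borel \<Longrightarrow> B \<subseteq> fst C \<Longrightarrow> emeasure vol B = chart_volume C B"
  using is_volume_vol by (simp add: is_volume_def)

text \<open>A null set in a chart would be Lebesgue null, because the density is strictly positive,
  but nonempty open sets are not negligible.\<close>

lemma emeasure_vol_open_pos:
  assumes "open W" "p \<in> W"
  shows "emeasure vol W \<noteq> 0"
proof
  assume 0: "emeasure vol W = 0"
  obtain C where C: "C \<in> A" "p \<in> fst C" by (rule chart_at)
  let ?B = "W \<inter> fst C"
  let ?f = "\<lambda>x. volume_density h C (chart_inv C x)"
  have B: "open ?B" "?B \<in> sets borel" "?B \<subseteq> fst C" using assms C by auto
  have "emeasure vol ?B = 0"
    using 0 assms by (metis emeasure_mono inf_le1 le_zero_eq sets_vol borel_open)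
  then have "(\<integral>\<^sup>+x\<in>snd C ` ?B. ennreal (?f x) \<partial>lborel) = 0"
    using emeasure_vol_chart[OF C(1) B(2,3)] by (simp add: chart_volume_def)
  then have "(\<integral>\<^sup>+x. ennreal (indicator (snd C ` ?B) x *\<^sub>R ?f x) \<partial>lborel) = 0"
    by (subst (asm) nn_integral_cong[where v = "\<lambda>x. ennreal (indicator (snd C ` ?B) x *\<^sub>R ?f x)"])
      (auto simp: indicator_def)
  then have "AE x in lborel. ennreal (indicator (snd C ` ?B) x *\<^sub>R ?f x) = 0"
    using set_borel_measurable_volume_density[OF C(1) B(2,3)]
    by (subst (asm) nn_integral_0_iff_AE) (auto simp: set_borel_measurable_def)
  then have "AE x in lborel. x \<notin> snd C ` ?B"
  proof (rule AE_mp, intro AE_I2 impI)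
    fix x assume *: "ennreal (indicator (snd C ` ?B) x *\<^sub>R ?f x) = 0"
    show "x \<notin> snd C ` ?B"
    proof
      assume x: "x \<in> snd C ` ?B"
      then have "?f x > 0" using volume_density_pos[OF C(1)] C(1) by auto
      then show False using * x by simp
    qed
  qed
  moreover have "open (snd C ` ?B)" by (intro open_chart_image C B)
  moreover have "snd C ` ?B \<noteq> {}" using assms C by blast
  ultimately show False
    by (metis AE_iff_null_sets borel_open open_not_negligible negligible_iff_null_sets
        null_sets_completionI sets_lborel)
qed

text \<open>Every point has a neighbourhood whose chart image lies in a closed ball inside the
  chart; the density is bounded on that ball, and compactness leaves finitely many such
  neighbourhoods.\<close>

lemma finite_vol: "emeasure vol UNIV < \<infinity>"
proof -
  have "\<exists>W. open W \<and> p \<in> W \<and> emeasure vol W < \<infinity>" for p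
  proof -
    obtain C where C: "C \<in> A" "p \<in> fst C" by (rule chart_at)
    let ?f = "\<lambda>x. volume_density h C (chart_inv C x)"
    obtain r where r: "r > 0" "cball (snd C p) r \<subseteq> snd C ` fst C"
      using open_contains_cball_eq[OF chart_open(2)[OF C(1)]] C by blast
    define W where "W = fst C \<inter> snd C -` ball (snd C p) r"
    have W: "open W" "W \<subseteq> fst C" "p \<in> W" "snd C ` W \<subseteq> cball (snd C p) r"
      using continuous_open_preimage[OF continuous_on_chart[OF C(1)] chart_open(1)[OF C(1)] open_ball]
        C r(1) by (auto simp: W_def)
    have "compact (?f ` cball (snd C p) r)"
      using continuous_on_subset[OF continuous_on_volume_density[OF C(1)] r(2)]
      by (intro compact_continuous_image) auto
    then obtain b where b: "\<And>x. x \<in> cball (snd C p) r \<Longrightarrow> ?f x \<le> b"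
      by (metis bounded_imp_bdd_above compact_imp_bounded bdd_above.unfold imageI)
    have "emeasure vol W = (\<integral>\<^sup>+x\<in>snd C ` W. ennreal (?f x) \<partial>lborel)"
      using emeasure_vol_chart[OF C(1) _ W(2)] W(1) by (simp add: chart_volume_def)
    also have "\<dots> \<le> (\<integral>\<^sup>+x. ennreal b * indicator (cball (snd C p) r) x \<partial>lborel)"
      using W(4) b by (intro nn_integral_mono) (auto simp: indicator_def intro: ennreal_leI)
    also have "\<dots> = ennreal b * emeasure lborel (cball (snd C p) r)"
      by (intro nn_integral_cmult_indicator) simp
    also have "\<dots> < \<infinity>"
      using emeasure_bounded_finite[of "cball (snd C p) r"] by (simp add: ennreal_mult_less_top)
    finally show ?thesis using W by blast
  qed
  then obtain W where W: "\<And>p. open (W p)" "\<And>p. p \<in> W p" "\<And>p. emeasure vol (W p) < \<infinity>"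
    by metis
  obtain P where P: "finite P" "(\<Union>p\<in>P. W p) = UNIV"
    using compactE_image[OF compact, of UNIV W] W by (metis UNIV_I UN_I top.extremum_uniqueI subsetI)
  have "emeasure vol UNIV \<le> (\<Sum>p\<in>P. emeasure vol (W p))"
    unfolding P(2)[symmetric] using P W by (intro emeasure_subadditive_finite) auto
  also have "\<dots> < \<infinity>" using W(3) P(1) by simp
  finally show ?thesis .
qed

text \<open>Integrability is what later allows the energy to be split into the integrals belonging
  to the single forms.\<close>

lemma integrable_vol_continuous:
  assumes "continuous_on UNIV (f :: 'm \<Rightarrow> real)"
  shows "integrable vol f"
proof -
  have "finite_measure vol"
    using finite_vol by (intro finite_measureI) simp
  moreover obtain b where "\<And>p. norm (f p) \<le> b"
    using compact_imp_bounded[OF compact_continuous_image[OF assms compact]]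
    by (auto simp: bounded_iff)
  moreover have "f \<in> borel_measurable vol"
    using borel_measurable_continuous_onI[OF assms] by simp
  ultimately show ?thesis
    by (intro finite_measure.integrable_const_bound[where B = b]) auto
qed

text \<open>The set where \<open>f\<close> is nonzero is open and null, hence empty.\<close>

lemma integral_vol_eq_0D:
  assumes f: "continuous_on UNIV (f :: 'm \<Rightarrow> real)" "\<And>p. f p \<ge> 0" and 0: "(\<integral>p. f p \<partial>vol) = 0"
  shows "f p = 0"
proof (rule ccontr)
  assume "f p \<noteq> 0"
  have "AE q in vol. f q = 0"
    using integral_nonneg_eq_0_iff_AE[OF integrable_vol_continuous[OF f(1)]] f(2) 0 by simp
  moreover have W: "open {q. f q \<noteq> 0}"
    using f(1) by (intro open_Collect_neq) auto
  ultimately have "emeasure vol {q. f q \<noteq> 0} = 0"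
    by (subst (asm) AE_iff_measurable[OF _ refl]) auto
  then show False
    using emeasure_vol_open_pos[OF W, of p] \<open>f p \<noteq> 0\<close> by simp
qed

subsection \<open>The energy density\<close>

abbreviation dchart :: "('m \<Rightarrow> 'e::real_normed_vector) \<Rightarrow> ('m, 'n) chart \<Rightarrow> 'm \<Rightarrow> real^'n::_ \<Rightarrow> 'e" where
  "dchart \<phi> C p \<equiv> frechet_derivative (\<phi> \<circ> chart_inv C) (at (snd C p))"

lemma smooth_map_has_derivative:
  assumes "smooth_map_into A N \<phi>" "C \<in> A" "p \<in> fst C"
  shows "(\<phi> \<circ> chart_inv C has_derivative dchart \<phi> C p) (at (snd C p))"
proof -
  have "Ck_on (Suc 0) (\<phi> \<circ> chart_inv C) (snd C ` fst C)"
    using assms unfolding smooth_map_into_def smooth_on_def by blast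
  from Ck_on_has_derivative[OF this] show ?thesis using assms by simp
qed

lemma linear_dchart:
  assumes "smooth_map_into A N \<phi>" "C \<in> A" "p \<in> fst C"
  shows "linear (dchart \<phi> C p)"
  using smooth_map_has_derivative[OF assms] by (rule has_derivative_linear)

lemma continuous_on_dchart:
  assumes "smooth_map_into A N \<phi>" "C \<in> A"
  shows "continuous_on (fst C) (\<lambda>p. dchart \<phi> C p v)"
proof -
  have "Ck_on (Suc 0) (\<phi> \<circ> chart_inv C) (snd C ` fst C)"
    using assms unfolding smooth_map_into_def smooth_on_def by blast
  then have "continuous_on (snd C ` fst C) (\<lambda>x. frechet_derivative (\<phi> \<circ> chart_inv C) (at x) v)"
    by simp
  then show ?thesis
    by (rule continuous_on_compose2[OF _ continuous_on_chart[OF assms(2)]]) simp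
qed

lemma continuous_on_smooth_map:
  assumes "smooth_map_into A N \<phi>" "C \<in> A"
  shows "continuous_on (fst C) \<phi>"
proof -
  have "Ck_on 0 (\<phi> \<circ> chart_inv C) (snd C ` fst C)"
    using assms unfolding smooth_map_into_def smooth_on_def by blast
  then have "continuous_on (snd C ` fst C) (\<lambda>x. \<phi> (chart_inv C x))"
    by (simp add: o_def)
  then have "continuous_on (fst C) (\<lambda>p. \<phi> (chart_inv C (snd C p)))"
    by (rule continuous_on_compose2[OF _ continuous_on_chart[OF assms(2)]]) simp
  then show ?thesis using assms(2) by (simp cong: continuous_on_cong)
qed

text \<open>Near the point, \<open>\<phi>\<close> in the chart \<open>C\<close> is
  \<open>\<phi>\<close> in the chart \<open>D\<close> after the transition map, so this is the chain
  rule.\<close>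

lemma dchart_transition:
  assumes \<phi>: "smooth_map_into A N \<phi>" and C: "C \<in> A" "p \<in> fst C" and D: "D \<in> A" "p \<in> fst D"
  shows "dchart \<phi> C p v = dchart \<phi> D p (frechet_derivative (transition C D) (at (snd C p)) v)"
proof -
  let ?T = "frechet_derivative (transition C D) (at (snd C p))"
  let ?S = "snd C ` (fst C \<inter> fst D)"
  have Tp: "transition C D (snd C p) = snd D p" using C by (simp add: transition_def)
  have "((\<phi> \<circ> chart_inv D) has_derivative dchart \<phi> D p) (at (transition C D (snd C p)))"
    unfolding Tp by (rule smooth_map_has_derivative[OF \<phi> D])
  from diff_chain_at[OF transition_has_derivative[OF C(1) D(1) C(2) D(2)] this]
  have "((\<phi> \<circ> chart_inv D) \<circ> transition C D has_derivative dchart \<phi> D p \<circ> ?T) (at (snd C p))" .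
  moreover have "open ?S" "snd C p \<in> ?S"
    using open_chart_image[OF C(1) open_Int[OF chart_open(1)[OF C(1)] chart_open(1)[OF D(1)]]] C D
    by auto
  moreover have "((\<phi> \<circ> chart_inv D) \<circ> transition C D) x = (\<phi> \<circ> chart_inv C) x" if "x \<in> ?S" for x
    using that C(1) D(1) by (auto simp: transition_def)
  ultimately have "(\<phi> \<circ> chart_inv C has_derivative dchart \<phi> D p \<circ> ?T) (at (snd C p))"
    by (rule has_derivative_transform_within_open)
  then have "dchart \<phi> D p \<circ> ?T = dchart \<phi> C p"
    by (rule frechet_derivative_at)
  then show ?thesis by (metis comp_apply)
qed

text \<open>The derivative of the transition map is an isometry of the two coordinate metrics. It
  carries an orthonormal frame to one, and the differential takes equal values on corresponding
  vectors.\<close>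

lemma norm_sq_differential_chart:
  assumes \<phi>: "smooth_map_into A N \<phi>" and C: "C \<in> A" "p \<in> fst C" and k: "bilinear (k (\<phi> p))"
  shows "norm_sq_differential A h k \<phi> p = hs_norm_sq (h C p) (k (\<phi> p)) (dchart \<phi> C p)"
proof -
  define D where "D = (SOME C. C \<in> A \<and> p \<in> fst C)"
  have D: "D \<in> A" "p \<in> fst D"
    using someI[of "\<lambda>C. C \<in> A \<and> p \<in> fst C" C] C unfolding D_def by auto
  let ?T = "frechet_derivative (transition C D) (at (snd C p))"
  obtain e where e: "orthonormal_frame (h C p) e"
    using ex_orthonormal_frame[OF inner_form_metric[OF C]] ..
  have "h C p v w = h D p (?T v) (?T w)" for v w
    using metric C D unfolding riemannian_metric_def by blast
  then have Te: "orthonormal_frame (h D p) (\<lambda>i. ?T (e i))"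
    using e by (simp add: orthonormal_frame_def)
  have bil: "bilinear (h C p)" "bilinear (h D p)"
    using inner_form_metric C D by (auto simp: inner_form_def)
  have "norm_sq_differential A h k \<phi> p = hs_norm_sq (h D p) (k (\<phi> p)) (dchart \<phi> D p)"
    by (simp add: norm_sq_differential_def D_def[symmetric])
  also have "\<dots> = hs_norm_sq (h C p) (k (\<phi> p)) (dchart \<phi> C p)"
    unfolding hs_norm_sq_eq[OF bil(2) Te k linear_dchart[OF \<phi> D]]
      hs_norm_sq_eq[OF bil(1) e k linear_dchart[OF \<phi> C]]
    by (simp add: dchart_transition[OF \<phi> C D])
  finally show ?thesis .
qed

end

text \<open>The degenerate form given by the square of the one-form \<open>\<omega>\<close>. Since
  \<open>norm_sq_differential\<close> accepts such forms as \<open>k\<close>, it also measures the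
  part of the energy carried by one member of a coframe.\<close>

definition form_sq :: "('e \<Rightarrow> 'e \<Rightarrow> real) \<Rightarrow> 'e \<Rightarrow> 'e \<Rightarrow> 'e \<Rightarrow> real" where
  "form_sq \<omega> q v w = \<omega> q v * \<omega> q w"

lemma bilinear_form_sq: "linear (\<omega> q) \<Longrightarrow> bilinear (form_sq \<omega> q)"
  unfolding bilinear_def form_sq_def
  by (auto intro!: linearI simp: linear_add linear_scale algebra_simps)

section \<open>Energy carried by single one-forms\<close>

context compact_riemannian begin

lemma norm_sq_form_nonneg: "norm_sq_differential A h (form_sq \<omega>) \<phi> p \<ge> 0"
  by (simp add: norm_sq_differential_def hs_norm_sq_def Let_def form_sq_def sum_nonneg)

text \<open>The density is the sum of the squares of \<open>\<omega>\<close> on the images of frame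
  vectors; if it vanishes, so does every term, and the frame spans.\<close>

lemma norm_sq_form_eq_0D:
  assumes \<phi>: "smooth_map_into A N \<phi>" and C: "C \<in> A" "p \<in> fst C" and \<omega>: "linear (\<omega> (\<phi> p))"
    and 0: "norm_sq_differential A h (form_sq \<omega>) \<phi> p = 0"
  shows "\<omega> (\<phi> p) (dchart \<phi> C p v) = 0"
proof -
  have k: "bilinear (form_sq \<omega> (\<phi> p))" using \<omega> by (rule bilinear_form_sq)
  have hb: "bilinear (h C p)" using inner_form_metric[OF C] by (simp add: inner_form_def)
  obtain e where e: "orthonormal_frame (h C p) e"
    using ex_orthonormal_frame[OF inner_form_metric[OF C]] ..
  have "(\<Sum>i\<in>UNIV. (\<omega> (\<phi> p) (dchart \<phi> C p (e i)))\<^sup>2) = 0"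
    using 0 unfolding norm_sq_differential_chart[where k = "form_sq \<omega>", OF \<phi> C k]
      hs_norm_sq_eq[OF hb e k linear_dchart[OF \<phi> C]]
    by (simp add: form_sq_def power2_eq_square)
  then have "(\<omega> (\<phi> p) \<circ> dchart \<phi> C p) (e i) = 0" for i
    by (subst (asm) sum_nonneg_eq_0_iff) auto
  then have "(\<omega> (\<phi> p) \<circ> dchart \<phi> C p) v = 0"
    by (rule orthonormal_frame_span[OF hb e linear_compose[OF linear_dchart[OF \<phi> C] \<omega>]])
  then show ?thesis by simp
qed

text \<open>On one chart domain the Cramer formula is built from continuous functions; these domains
  are open and cover the manifold.\<close>

lemma continuous_norm_sq_form:
  assumes \<phi>: "smooth_map_into A N \<phi>" and \<omega>: "\<And>q. q \<in> N \<Longrightarrow> linear (\<omega> q)"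
    and cont: "continuous_on (N \<times> UNIV) (\<lambda>(q, v). \<omega> q v)"
  shows "continuous_on UNIV (norm_sq_differential A h (form_sq \<omega>) \<phi>)"
proof -
  have N: "\<phi> p \<in> N" for p using \<phi> by (auto simp: smooth_map_into_def)
  have "continuous_on (fst C) (norm_sq_differential A h (form_sq \<omega>) \<phi>)" if C: "C \<in> A" for C
  proof -
    have 1: "continuous_on (fst C) (\<lambda>p. \<omega> (\<phi> p) (dchart \<phi> C p v))" for v
      using continuous_on_compose2[OF cont continuous_on_Pair[OF continuous_on_smooth_map[OF \<phi> C]
          continuous_on_dchart[OF \<phi> C, of v]]] N by auto
    have 2: "continuous_on (fst C) (\<lambda>p. cramer_inv (gram (h C p)) $ j $ k)" for j k
      using det_gram_pos[OF inner_form_metric[OF C]] continuous_on_metric[OF C]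
      by (intro continuous_on_cramer_inv) (auto simp: gram_def less_imp_neq[THEN not_sym])
    have "continuous_on (fst C) (\<lambda>p. \<Sum>j\<in>UNIV. \<Sum>k\<in>UNIV. cramer_inv (gram (h C p)) $ j $ k *
        form_sq \<omega> (\<phi> p) (dchart \<phi> C p (axis j 1)) (dchart \<phi> C p (axis k 1)))"
      unfolding form_sq_def by (intro continuous_intros 1 2)
    moreover have "norm_sq_differential A h (form_sq \<omega>) \<phi> p =
        (\<Sum>j\<in>UNIV. \<Sum>k\<in>UNIV. cramer_inv (gram (h C p)) $ j $ k *
        form_sq \<omega> (\<phi> p) (dchart \<phi> C p (axis j 1)) (dchart \<phi> C p (axis k 1)))" if "p \<in> fst C" for p
      using norm_sq_differential_chart[where k = "form_sq \<omega>", OF \<phi> C that bilinear_form_sq[where \<omega> = \<omega>, OF \<omega>[OF N]]]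
        hs_norm_sq_cramer[OF inner_form_metric[OF C that] bilinear_form_sq[where \<omega> = \<omega>, OF \<omega>[OF N]]
          linear_dchart[OF \<phi> C that]] by simp
    ultimately show ?thesis by (simp cong: continuous_on_cong)
  qed
  then show ?thesis
    using chart_open(1) chart_at
    by (metis UNIV_I continuous_at_imp_continuous_on continuous_on_eq_continuous_at)
qed

text \<open>The chosen chart depends only on \<open>p\<close> and the chosen frame only on
  \<open>h C p\<close>, so both densities use the same ones and the factor leaves each summand.
  \<open>eq\<close> concerns vectors in the range of the differential only; the later variations
  satisfy no more than that.\<close>

lemma norm_sq_form_compose:
  assumes \<phi>: "smooth_map_into A N \<phi>" and \<psi>: "(\<psi> has_derivative \<psi>') (at (\<phi> p))"
    and eq: "\<And>C v. C \<in> A \<Longrightarrow> p \<in> fst C \<Longrightarrow>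
      \<omega> (\<psi> (\<phi> p)) (\<psi>' (dchart \<phi> C p v)) = c * \<omega> (\<phi> p) (dchart \<phi> C p v)"
  shows "norm_sq_differential A h (form_sq \<omega>) (\<lambda>p. \<psi> (\<phi> p)) p =
    c\<^sup>2 * norm_sq_differential A h (form_sq \<omega>) \<phi> p"
proof -
  define C where "C = (SOME C. C \<in> A \<and> p \<in> fst C)"
  have C: "C \<in> A" "p \<in> fst C"
    using someI_ex[of "\<lambda>C. C \<in> A \<and> p \<in> fst C"] chart_at[of p] unfolding C_def by blast+
  have "(\<phi> \<circ> chart_inv C) (snd C p) = \<phi> p" using C by simp
  then have "(\<psi> \<circ> (\<phi> \<circ> chart_inv C) has_derivative \<psi>' \<circ> dchart \<phi> C p) (at (snd C p))"
    using diff_chain_at[OF smooth_map_has_derivative[OF \<phi> C]] \<psi> by metis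
  moreover have "\<psi> \<circ> (\<phi> \<circ> chart_inv C) = (\<lambda>p. \<psi> (\<phi> p)) \<circ> chart_inv C"
    by (simp add: fun_eq_iff)
  ultimately have "dchart (\<lambda>p. \<psi> (\<phi> p)) C p = \<psi>' \<circ> dchart \<phi> C p"
    using frechet_derivative_at by metis
  then show ?thesis
    by (simp add: norm_sq_differential_def C_def[symmetric] hs_norm_sq_def Let_def form_sq_def
        eq[OF C] sum_distrib_left power2_eq_square mult_ac)
qed

lemma norm_sq_sum:
  "norm_sq_differential A h (\<lambda>q v w. \<Sum>i\<in>I. form_sq (\<omega> i) q v w) \<phi> p =
    (\<Sum>i\<in>I. norm_sq_differential A h (form_sq (\<omega> i)) \<phi> p)"
  unfolding norm_sq_differential_def hs_norm_sq_def Let_def by (rule sum.swap)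

text \<open>The variation multiplies the part of the energy coming from \<open>J\<close> by \<open>(1 + u)\<^sup>2\<close> and
  fixes the rest, so criticality forces the former to vanish.\<close>

lemma harmonic_scaling:
  fixes \<omega> :: "'i \<Rightarrow> 'e::real_normed_vector \<Rightarrow> 'e \<Rightarrow> real" and \<psi> :: "real \<Rightarrow> 'e \<Rightarrow> 'e"
  assumes harm: "harmonic_map A h N (\<lambda>q v w. \<Sum>i\<in>I. form_sq (\<omega> i) q v w) \<phi>"
    and conn: "connected (UNIV :: 'm set)"
    and I: "finite I" "J \<subseteq> I"
    and \<omega>: "\<And>i q. i \<in> I \<Longrightarrow> q \<in> N \<Longrightarrow> linear (\<omega> i q)"
      "\<And>i. i \<in> I \<Longrightarrow> continuous_on (N \<times> UNIV) (\<lambda>(q, v). \<omega> i q v)"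
    and \<psi>: "\<And>q. q \<in> N \<Longrightarrow> \<psi> 0 q = q" "\<And>u q. u \<in> {-1<..<1} \<Longrightarrow> q \<in> N \<Longrightarrow> \<psi> u q \<in> N"
      "\<And>u q. u \<in> {-1<..<1} \<Longrightarrow> q \<in> N \<Longrightarrow> (\<psi> u has_derivative \<psi>' u q) (at q)"
    and smooth: "\<And>C. C \<in> A \<Longrightarrow>
      smooth_on (\<lambda>(u, x). \<psi> u (\<phi> (chart_inv C x))) ({-1<..<1} \<times> snd C ` fst C)"
    and scale: "\<And>u i C p v. u \<in> {-1<..<1} \<Longrightarrow> i \<in> I \<Longrightarrow> C \<in> A \<Longrightarrow> p \<in> fst C \<Longrightarrow>
      \<omega> i (\<psi> u (\<phi> p)) (\<psi>' u (\<phi> p) (dchart \<phi> C p v)) =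
      (if i \<in> J then 1 + u else 1) * \<omega> i (\<phi> p) (dchart \<phi> C p v)"
    and i: "i \<in> J" and C: "C \<in> A" "p \<in> fst C"
  shows "\<omega> i (\<phi> p) (dchart \<phi> C p v) = 0"
proof -
  let ?k = "\<lambda>q v w. \<Sum>i\<in>I. form_sq (\<omega> i) q v w"
  define P where "P i = norm_sq_differential A h (form_sq (\<omega> i)) \<phi>" for i
  have sm: "smooth_map_into A N \<phi>" using harm by (simp add: harmonic_map_def)
  have N: "\<phi> p \<in> N" for p using sm by (auto simp: smooth_map_into_def)
  have P: "continuous_on UNIV (P i)" "\<And>p. P i p \<ge> 0" if "i \<in> I" for i
    unfolding P_def using that by (auto intro!: continuous_norm_sq_form[OF sm] \<omega> norm_sq_form_nonneg)
  have int: "integrable vol (P i)" if "i \<in> I" for i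
    using P(1)[OF that] by (rule integrable_vol_continuous)
  let ?\<Phi> = "\<lambda>u p. \<psi> u (\<phi> p)"
  \<comment> \<open>With \<open>D = UNIV\<close> the support condition is trivial; compactness and
    connectedness make \<open>UNIV\<close> a compact domain.\<close>
  have "smooth_variation A N \<phi> UNIV 1 ?\<Phi>"
    unfolding smooth_variation_def using \<psi>(1,2) N smooth by auto
  moreover have "compact_domain (UNIV :: 'm set)"
    using compact conn by (simp add: compact_domain_def)
  ultimately have E0: "((\<lambda>u. energy A h ?k (?\<Phi> u) UNIV) has_real_derivative 0) (at 0)"
    using harm unfolding harmonic_map_def by (metis zero_less_one)
  define a where "a = (\<Sum>i\<in>I - J. \<integral>p. P i p \<partial>vol)"
  define b where "b = (\<Sum>i\<in>J. \<integral>p. P i p \<partial>vol)"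
  have E: "1/2 * (a + (1 + u)\<^sup>2 * b) = energy A h ?k (?\<Phi> u) UNIV" if u: "u \<in> {-1<..<1}" for u
  proof -
    have "norm_sq_differential A h ?k (?\<Phi> u) p = (\<Sum>i\<in>I. (if i \<in> J then 1 + u else 1)\<^sup>2 * P i p)" for p
      unfolding norm_sq_sum P_def
      by (intro sum.cong refl norm_sq_form_compose[OF sm \<psi>(3)[OF u N]] scale u)
    then have "energy A h ?k (?\<Phi> u) UNIV =
        1/2 * (\<integral>p. (\<Sum>i\<in>I. (if i \<in> J then 1 + u else 1)\<^sup>2 * P i p) \<partial>vol)"
      by (simp add: energy_def set_lebesgue_integral_def)
    also have "\<dots> = 1/2 * (\<Sum>i\<in>I. (if i \<in> J then 1 + u else 1)\<^sup>2 * (\<integral>p. P i p \<partial>vol))"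
      by (subst Bochner_Integration.integral_sum) (simp_all add: int)
    also have "(\<Sum>i\<in>I. (if i \<in> J then 1 + u else 1)\<^sup>2 * (\<integral>p. P i p \<partial>vol)) = a + (1 + u)\<^sup>2 * b"
      unfolding sum.subset_diff[OF I(2,1)] a_def b_def by (simp add: sum_distrib_left)
    finally show ?thesis ..
  qed
  \<comment> \<open>The 2 from the square cancels the \<open>1/2\<close>, leaving \<open>b\<close>
    itself. The formula for the energy holds only for \<open>\<bar>u\<bar> < 1\<close>, which
    suffices for the derivative at 0.\<close>
  have "((\<lambda>u. 1/2 * (a + (1 + u)\<^sup>2 * b)) has_real_derivative b) (at 0)"
    by (auto intro!: derivative_eq_intros)
  then have "((\<lambda>u. energy A h ?k (?\<Phi> u) UNIV) has_real_derivative b) (at 0)"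
    by (rule has_field_derivative_transform_within_open[OF _ open_greaterThanLessThan]) (use E in auto)
  then have "b = 0" using E0 DERIV_unique by blast
  moreover have "finite J" using I finite_subset by blast
  moreover have "(\<integral>p. P j p \<partial>vol) \<ge> 0" if "j \<in> J" for j
    using P(2) I(2) that by (intro integral_nonneg_AE AE_I2) blast
  ultimately have "(\<integral>p. P i p \<partial>vol) = 0"
    using sum_nonneg_0[of J "\<lambda>j. \<integral>p. P j p \<partial>vol" i] i unfolding b_def by blast
  moreover have "i \<in> I" using i I(2) by blast
  ultimately have "P i p = 0"
    using integral_vol_eq_0D[OF P] by blast
  then show ?thesis
    using norm_sq_form_eq_0D[where \<omega> = "\<omega> i", OF sm C \<omega>(1)[OF \<open>i \<in> I\<close> N]] unfolding P_def by blast
qed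

end

section \<open>Scaling variations in \<open>F\<^sup>4\<close>\<close>

abbreviation (input) "cx \<equiv> \<lambda>q::real4. fst q"
abbreviation (input) "cy \<equiv> \<lambda>q::real4. fst (snd q)"
abbreviation (input) "cs \<equiv> \<lambda>q::real4. fst (snd (snd q))"
abbreviation (input) "ct \<equiv> \<lambda>q::real4. snd (snd (snd q))"

text \<open>The forms are defined by patterns on tuples; written with projections they are open to
  the rules for linearity and continuity.\<close>

lemma theta_coordinates:
  "theta1 q v = cx v / sqrt (ct q) - cs q / sqrt (ct q) * cy v"
  "theta2 q v = sqrt (ct q) * cy v"
  "theta3 q v = cs v / (2 * ct q)"
  "theta4 q v = ct v / (2 * ct q)"
  by (cases q; cases v; simp)+

lemma F4_iff: "q \<in> F4 \<longleftrightarrow> ct q > 0"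
  by (cases q) (simp add: F4_def)

definition theta :: "nat \<Rightarrow> real4 \<Rightarrow> real4 \<Rightarrow> real" where
  "theta i = [theta1, theta2, theta3, theta4] ! i"

lemma F4_metric_theta: "F4_metric = (\<lambda>q v w. \<Sum>i\<in>{..<4}. form_sq (theta i) q v w)"
  by (simp add: fun_eq_iff F4_metric_def form_sq_def theta_def numeral_eq_Suc lessThan_Suc)

lemma less_4_cases: "(i::nat) < 4 \<Longrightarrow> i = 0 \<or> i = 1 \<or> i = 2 \<or> i = 3"
  by auto

lemma theta_nth [simp]:
  "theta 0 = theta1" "theta (Suc 0) = theta2" "theta 2 = theta3" "theta 3 = theta4"
  by (simp_all add: theta_def numeral_eq_Suc)

lemma linear_theta: "i < 4 \<Longrightarrow> linear (theta i q)"
  by (drule less_4_cases, intro linearI)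
    (auto simp: theta_coordinates algebra_simps add_divide_distrib)

lemma continuous_on_theta: "i < 4 \<Longrightarrow> continuous_on (F4 \<times> UNIV) (\<lambda>(q, v). theta i q v)"
  by (drule less_4_cases)
    (auto simp: theta_coordinates F4_iff split_beta intro!: continuous_intros)

definition "fibre_scaling u q = ((1 + u) * cx q, (1 + u) * cy q, cs q, ct q)"
definition "s_scaling u q = (cx q, cy q, (1 + u) * cs q, ct q)"
text \<open>For \<open>t > 0\<close> the last entry is \<open>t powr (1 + u)\<close>, written with
  products, \<open>exp\<close> and \<open>ln\<close> so that the rules above give smoothness jointly
  in \<open>u\<close> and the point.\<close>

definition "t_power u q = (cx q, cy q, cs q, ct q * exp (u * ln (ct q)))"

lemma variation_0: "fibre_scaling 0 q = q" "s_scaling 0 q = q" "t_power 0 q = q"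
  by (simp_all add: fibre_scaling_def s_scaling_def t_power_def)

lemma variation_F4:
  assumes "q \<in> F4"
  shows "fibre_scaling u q \<in> F4" "s_scaling u q \<in> F4" "t_power u q \<in> F4"
  using assms by (simp_all add: F4_iff fibre_scaling_def s_scaling_def t_power_def)

text \<open>For fixed \<open>u\<close> the map is linear, so it is its own derivative.\<close>

lemma fibre_scaling_derivative: "(fibre_scaling u has_derivative fibre_scaling u) (at q)"
  unfolding fibre_scaling_def[abs_def] by (auto intro!: derivative_eq_intros)

lemma s_scaling_derivative: "(s_scaling u has_derivative s_scaling u) (at q)"
  unfolding s_scaling_def[abs_def] by (auto intro!: derivative_eq_intros)

lemma t_power_derivative:
  assumes "q \<in> F4"
  shows "(t_power u has_derivative
    (\<lambda>v. (cx v, cy v, cs v, (1 + u) * exp (u * ln (ct q)) * ct v))) (at q)"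
  using assms unfolding t_power_def[abs_def] F4_iff
  by (auto intro!: derivative_eq_intros simp: fun_eq_iff field_simps)

section \<open>Smoothness of the variations and conclusion\<close>

context compact_riemannian begin

lemma smooth_variations:
  assumes \<phi>: "smooth_map_into A F4 \<phi>" and C: "C \<in> A"
  shows "smooth_on (\<lambda>(u, x). fibre_scaling u (\<phi> (chart_inv C x))) ({-1<..<1} \<times> snd C ` fst C)"
    and "smooth_on (\<lambda>(u, x). s_scaling u (\<phi> (chart_inv C x))) ({-1<..<1} \<times> snd C ` fst C)"
    and "smooth_on (\<lambda>(u, x). t_power u (\<phi> (chart_inv C x))) ({-1<..<1} \<times> snd C ` fst C)"
proof -
  let ?S = "{-1<..<1::real} \<times> snd C ` fst C"
  let ?\<phi> = "\<lambda>z. \<phi> (chart_inv C (snd z))"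
  have S: "open ?S" using C by (intro open_Times) auto
  have L: "bounded_linear cx" "bounded_linear cy" "bounded_linear cs" "bounded_linear ct"
    by (intro bounded_linear_intros)+
  note I = Ck_on_Pair[OF S] Ck_on_add[OF S] Ck_on_mult[OF S] Ck_on_exp[OF S] Ck_on_ln[OF S] Ck_on_const[OF S]
  have u: "Ck_on k (\<lambda>z. fst z) ?S" for k
    using Ck_on_bounded_linear[OF bounded_linear_fst S Ck_on_ident[OF S]] .
  have "Ck_on k ?\<phi> ?S" for k
  proof -
    have "Ck_on k (\<phi> \<circ> chart_inv C) (snd C ` fst C)"
      using \<phi> C unfolding smooth_map_into_def smooth_on_def by blast
    \<comment> \<open>The map does not depend on \<open>u\<close>: as a function of
      \<open>(u, x)\<close> it is its chart expression after the projection
      \<open>snd\<close>.\<close>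
    from Ck_on_compose_linear[OF bounded_linear_snd chart_open(2)[OF C] S _ this]
    show ?thesis by (simp add: snd_image_times)
  qed
  note c = L[THEN Ck_on_bounded_linear, OF S this]
  have pos: "ct (?\<phi> z) > 0" for z
    using \<phi> by (auto simp: smooth_map_into_def F4_iff image_subset_iff)
  show "smooth_on (\<lambda>(u, x). fibre_scaling u (\<phi> (chart_inv C x))) ?S"
    unfolding smooth_on_def split_beta fibre_scaling_def by (intro allI I c u)
  show "smooth_on (\<lambda>(u, x). s_scaling u (\<phi> (chart_inv C x))) ?S"
    unfolding smooth_on_def split_beta s_scaling_def by (intro allI I c u)
  show "smooth_on (\<lambda>(u, x). t_power u (\<phi> (chart_inv C x))) ?S"
    unfolding smooth_on_def split_beta t_power_def by (intro allI I c u pos)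
qed

text \<open>A ball in a chart image is convex, so a vanishing derivative makes the map constant on
  it; connectedness passes from locally constant to constant.\<close>

lemma constant_if_dchart_0:
  assumes conn: "connected (UNIV :: 'm set)" and \<phi>: "smooth_map_into A N \<phi>"
    and 0: "\<And>C p v. C \<in> A \<Longrightarrow> p \<in> fst C \<Longrightarrow> dchart \<phi> C p v = 0"
  shows "\<phi> constant_on UNIV"
proof (rule locally_constant_imp_constant[OF conn])
  fix p :: 'm
  obtain C where C: "C \<in> A" "p \<in> fst C" by (rule chart_at)
  obtain r where r: "r > 0" "ball (snd C p) r \<subseteq> snd C ` fst C"
    using open_contains_ball_eq[OF chart_open(2)[OF C(1)]] C by blast
  define W where "W = fst C \<inter> snd C -` ball (snd C p) r"
  have W: "open W" "W \<subseteq> fst C" "p \<in> W"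
    using continuous_open_preimage[OF continuous_on_chart[OF C(1)] chart_open(1)[OF C(1)] open_ball]
      C r(1) by (auto simp: W_def)
  have "(\<phi> \<circ> chart_inv C has_derivative (\<lambda>v. 0)) (at x within ball (snd C p) r)"
    if x: "x \<in> ball (snd C p) r" for x
  proof -
    obtain q where q: "q \<in> fst C" "x = snd C q" using x r(2) by blast
    have "dchart \<phi> C q = (\<lambda>v. 0)" using 0[OF C(1) q(1)] by (intro ext)
    then have "(\<phi> \<circ> chart_inv C has_derivative (\<lambda>v. 0)) (at x)"
      using smooth_map_has_derivative[OF \<phi> C(1) q(1)] unfolding q(2) by simp
    then show ?thesis by (rule has_derivative_at_withinI)
  qed
  from has_derivative_zero_constant[OF convex_ball this]
  obtain c where c: "\<And>x. x \<in> ball (snd C p) r \<Longrightarrow> (\<phi> \<circ> chart_inv C) x = c" by blast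
  have "\<phi> q = c" if "q \<in> W" for q
    using that c[of "snd C q"] C(1) by (auto simp: W_def)
  then have const: "\<forall>q\<in>W. \<phi> q = \<phi> p" using W(3) by simp
  have "openin (top_of_set UNIV) W" using W(1) by (simp flip: open_openin)
  with const W(3) show "\<exists>T. openin (top_of_set UNIV) T \<and> p \<in> T \<and> (\<forall>q\<in>T. \<phi> q = \<phi> p)"
    by blast
qed

lemma harmonic_F4_constant:
  assumes conn: "connected (UNIV :: 'm set)" and harm: "harmonic_map A h F4 F4_metric \<phi>"
  shows "\<phi> constant_on UNIV"
proof -
  have sm: "smooth_map_into A F4 \<phi>" using harm by (simp add: harmonic_map_def)
  have pos: "ct (\<phi> p) > 0" for p
    using sm by (auto simp: smooth_map_into_def F4_iff image_subset_iff)
  note scaling = harmonic_scaling[OF harm[unfolded F4_metric_theta] conn finite_lessThan,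
      OF _ linear_theta continuous_on_theta, simplified]
  have 1: "theta i (\<phi> p) (dchart \<phi> C p v) = 0" if "C \<in> A" "p \<in> fst C" "i \<in> {0, 1}" for C p v i
  proof (rule scaling[where J = "{0, 1}" and \<psi> = fibre_scaling and \<psi>' = "\<lambda>u q. fibre_scaling u"])
    show "theta j (fibre_scaling u (\<phi> p)) (fibre_scaling u (dchart \<phi> C p v)) =
        (if j \<in> {0, 1} then 1 + u else 1) * theta j (\<phi> p) (dchart \<phi> C p v)" if "j < 4" for u j C p v
      using less_4_cases[OF that]
      by (auto simp: theta_coordinates fibre_scaling_def algebra_simps add_divide_distrib)
  qed (use that in \<open>simp_all add: variation_0 variation_F4 fibre_scaling_derivative smooth_variations[OF sm]\<close>)
  \<comment> \<open>\<open>theta2\<close> is a positive multiple of \<open>dy\<close> alone, so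
    \<open>dy\<close> comes first; only then does \<open>theta1\<close> isolate
    \<open>dx\<close>.\<close>
  have dy: "cy (dchart \<phi> C p v) = 0" if "C \<in> A" "p \<in> fst C" for C p v
    using 1[OF that, of 1 v] pos[of p] by (simp add: theta_coordinates)
  have dx: "cx (dchart \<phi> C p v) = 0" if "C \<in> A" "p \<in> fst C" for C p v
    using 1[OF that, of 0 v] dy[OF that, of v] pos[of p] by (simp add: theta_coordinates)
  \<comment> \<open>Index 2 is \<open>theta3\<close>. Scaling \<open>s\<close> changes the
    coefficient of \<open>dy\<close> in \<open>theta1\<close>, which is invisible because
    \<open>dy\<close> already vanishes.\<close>
  have 2: "theta i (\<phi> p) (dchart \<phi> C p v) = 0" if "C \<in> A" "p \<in> fst C" "i \<in> {2}" for C p v i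
  proof (rule scaling[where J = "{2}" and \<psi> = s_scaling and \<psi>' = "\<lambda>u q. s_scaling u"])
    show "theta j (s_scaling u (\<phi> p)) (s_scaling u (dchart \<phi> C p v)) =
        (if j \<in> {2} then 1 + u else 1) * theta j (\<phi> p) (dchart \<phi> C p v)"
      if "j < 4" "C \<in> A" "p \<in> fst C" for u j C p v
      using less_4_cases[OF that(1)] dx[OF that(2,3)] dy[OF that(2,3)]
      by (auto simp: theta_coordinates s_scaling_def)
  qed (use that in \<open>simp_all add: variation_0 variation_F4 s_scaling_derivative smooth_variations[OF sm]\<close>)
  have ds: "cs (dchart \<phi> C p v) = 0" if "C \<in> A" "p \<in> fst C" for C p v
    using 2[OF that, of 2 v] pos[of p] by (simp add: theta_coordinates)
  \<comment> \<open>Index 3 is \<open>theta4\<close>. Changing \<open>t\<close> alters the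
    coefficients of the other three forms, but these vanish on the range of the differential by
    \<open>dx\<close>, \<open>dy\<close> and \<open>ds\<close>.\<close>
  have 3: "theta i (\<phi> p) (dchart \<phi> C p v) = 0" if "C \<in> A" "p \<in> fst C" "i \<in> {3}" for C p v i
  proof (rule scaling[where J = "{3}" and \<psi> = t_power and
        \<psi>' = "\<lambda>u q v. (cx v, cy v, cs v, (1 + u) * exp (u * ln (ct q)) * ct v)"])
    show "theta j (t_power u (\<phi> p)) (cx (dchart \<phi> C p v), cy (dchart \<phi> C p v), cs (dchart \<phi> C p v),
          (1 + u) * exp (u * ln (ct (\<phi> p))) * ct (dchart \<phi> C p v)) =
        (if j \<in> {3} then 1 + u else 1) * theta j (\<phi> p) (dchart \<phi> C p v)"
      if "j < 4" "C \<in> A" "p \<in> fst C" for u j C p v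
      using less_4_cases[OF that(1)] dx[OF that(2,3)] dy[OF that(2,3)] ds[OF that(2,3)]
      by (auto simp: theta_coordinates t_power_def)
  qed (use that in \<open>simp_all add: variation_0 variation_F4 t_power_derivative smooth_variations[OF sm]\<close>)
  have dt: "ct (dchart \<phi> C p v) = 0" if "C \<in> A" "p \<in> fst C" for C p v
    using 3[OF that, of 3 v] pos[of p] by (simp add: theta_coordinates)
  show ?thesis
    using dx dy ds dt by (intro constant_if_dchart_0[OF conn sm]) (simp add: prod_eq_iff)
qed

end

theorem theorem3p1:
  fixes A :: "('m::{t2_space,second_countable_topology}, 'n::{finite,wellorder}) chart set"
    and h :: "('m, 'n) metric"
    and \<phi> :: "'m \<Rightarrow> real4"
  assumes "smooth_atlas A"
    and "riemannian_metric A h"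
    and "orientable A"
    and "compact (UNIV :: 'm set)"
    and "connected (UNIV :: 'm set)"
    and "harmonic_map A h F4 F4_metric \<phi>"
  shows "\<phi> constant_on UNIV"
proof -
  interpret compact_riemannian A h
    using assms by unfold_locales
  show ?thesis
    using assms by (intro harmonic_F4_constant)
qed

end
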